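(* Let $G_1,\dots,G_m$ be cumulative distribution functions and let $H_{G_1,\dots,G_m}$ be generated from $G_1,\dots,G_m$ by Form A (respectively, by Form B), as defined in the context. Suppose that $G_1,\dots,G_m$ and $F$ (respectively, $\varphi$) are cumulative distribution functions of continuous random variables and that $\mathcal U$, $\vartheta$ and all of $\mu_j,\ell_j,\nu_j,m_j$ are continuous and differentiable functions. Then $H_{G_1,\dots,G_m}$ is a cumulative distribution function of a continuous random variable.
   Context: A cumulative distribution function (cdf) is a non-decreasing right continuous $F:\mathbb{R}\to\mathbb{R}$ with limits $0$ at $-\infty$ and $1$ at $+\infty$. A continuous random variable is one whose distribution has a density with respect to Lebesgue measure, i.e. its cdf is of the form $F(x)=\int_{-\infty}^x f(t)\,dt$ with $f\ge 0$ integrable. Differentiability of an extended-real-valued function on $[0,1]^m$ is required at the points where it is finite. Conventions: $F(-\infty)=0$, $F(+\infty)=1$, $\int_a^b dF=F(b)-F(a)$ for $a,b\in\mathbb{R}\cup\{\pm\infty\}$; sup, inf and continuity for extended-real-valued functions are in $\mathbb{R}\cup\{\pm\infty\}$. A function $h$ on $[0,1]^m$ is right continuous if $h(s)\to h(t)$ as $s\to t$ with $s_i\ge t_i$ for all $i$. For cdfs $G_1,\dots,G_m$ ($m\ge1$) write $h(.)(x)=h(G_1(x),\dots,G_m(x))$, $\mathbf0=(0,\dots,0)$, $\mathbf1=(1,\dots,1)$. Say $f:\mathbb{R}\to\mathbb{R}\cup\{\pm\infty\}$ is compatible with a cdf $F$ if for every $x_0$ such that $f(x_0)$ is a discontinuity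 point of $F$, $f$ is continuous at $x_0$ and constant on some $[x_0,x_0+\delta)$, $\delta>0$. **Form A.** Data: $n\ge1$; $F:\mathbb{R}\to\mathbb{R}$; monotonic right continuous $\mathcal U,\vartheta:[0,1]^m\to\mathbb{R}$ and $\mu_j,\ell_j,\nu_j,m_j:[0,1]^m\to\mathbb{R}\cup\{\pm\infty\}$, $1\le j\le n$, with: (1) $F$ a cdf, $\mathcal U,\vartheta\ge0$; (2) $\mu_j,m_j,\mathcal U$ non-decreasing, $\ell_j,\nu_j,\vartheta$ non-increasing in all variables; (3) if $\mathcal U(\mathbf0)\ne\vartheta(\mathbf0)$, then [$\mathcal U(\mathbf0)=0$ or $\mu_j(\mathbf0)=\ell_j(\mathbf0)\ \forall j$] and [$\vartheta(\mathbf0)=0$ or $m_j(\mathbf0)=\nu_j(\mathbf0)\ \forall j$]; (4) if $\mathcal U(\mathbf0)=\vartheta(\mathbf0)\ne0$, then $\mu_j(\mathbf0)=\nu_j(\mathbf0)$ and $m_j(\mathbf0)=\ell_j(\mathbf0)\ \forall j$; (5) $\ell_j(\mathbf0)\le\mu_j(\mathbf0)\ \forall j$, and if $\vartheta(\mathbf0)\ne0$ then $m_j(\mathbf1)\le\nu_j(\mathbf1)\ \forall j$; (6) $\mu_n(\mathbf1)\ge\sup\{x:F(x)<1\}$ and $\ell_1(\mathbf1)\le\inf\{x:F(x)>0\}$; (7) $\mathcal U(\mathbf1)=1$; (8) $\vartheta(\mathbf1)=0$ or $\nu_j(\mathbf1)=m_j(\mathbf1)\ \forall j$; (9) $\mu_j(\mathbf1)=\ell_{j+1}(\mathbf1)$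 for $1\le j\le n-1$; (10) $F$ is continuous or all functions $x\mapsto\ell_j(.)(x)$, $x\mapsto\nu_j(.)(x)$ are compatible with $F$; moreover $F$ has no discontinuity at any of the values of $\ell_j,\mu_j,m_j,\nu_j$ at $\mathbf0$ and $\mathbf1$. The generated function is $$H_{G_1,\dots,G_m}(x)=\mathcal U(.)(x)\sum_{j=1}^n\int_{\ell_j(.)(x)}^{\mu_j(.)(x)}dF(t)-\vartheta(.)(x)\sum_{j=1}^n\int_{m_j(.)(x)}^{\nu_j(.)(x)}dF(t).$$ **Form B.** Data: $\eta\ge1$; $\varphi:\mathbb{R}\to\mathbb{R}$; monotonic right continuous $\mathcal U,\vartheta:[0,1]^m\to\mathbb{R}$ and $\mu_j,\ell_j,\nu_j,m_j:[0,1]^m\to\mathbb{R}\cup\{\pm\infty\}$, $1\le j\le\eta$, with: (1) $\varphi$ a cdf, $\mathcal U,\vartheta\ge0$; (2) $\mu_j,m_j,\mathcal U$ non-decreasing, $\ell_j,\nu_j,\vartheta$ non-increasing in all variables; (3) if $\mathcal U(\mathbf1)\ne\vartheta(\mathbf1)$, then [$\vartheta(\mathbf1)=0$ or $m_j(\mathbf1)=\nu_j(\mathbf1)\ \forall j$] and [$\mathcal U(\mathbf1)=0$ or $\ell_j(\mathbf1)=\mu_j(\mathbf1)\ \forall j$]; (4) if $\mathcal U(\mathbf1)=\vartheta(\mathbf1)\ne0$, then $\mu_j(\mathbf1)=\nu_j(\mathbf1)$ and $m_j(\mathbf1)=\ell_j(\mathbf1)\ \forall j$; (5) $m_j(\mathbf1)\le\nu_j(\mathbf1)\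 \forall j$, and if $\mathcal U(\mathbf1)\ne0$ then $\ell_j(\mathbf0)\le\mu_j(\mathbf0)\ \forall j$; (6) $\nu_\eta(\mathbf0)\ge\sup\{x:\varphi(x)<1\}$ and $m_1(\mathbf0)\le\inf\{x:\varphi(x)>0\}$; (7) $\vartheta(\mathbf0)=1$; (8) $\mathcal U(\mathbf0)=0$ or $\ell_j(\mathbf0)=\mu_j(\mathbf0)\ \forall j$; (9) $\nu_j(\mathbf0)=m_{j+1}(\mathbf0)$ for $1\le j\le\eta-1$; (10) $\varphi$ is continuous or all functions $x\mapsto\ell_j(.)(x)$, $x\mapsto\nu_j(.)(x)$ are compatible with $\varphi$; moreover $\varphi$ has no discontinuity at any of the values of $\ell_j,\mu_j,m_j,\nu_j$ at $\mathbf0$ and $\mathbf1$. The generated function is $$H_{G_1,\dots,G_m}(x)=1-\vartheta(.)(x)\sum_{j=1}^\eta\int_{m_j(.)(x)}^{\nu_j(.)(x)}d\varphi(t)+\mathcal U(.)(x)\sum_{j=1}^\eta\int_{\ell_j(.)(x)}^{\mu_j(.)(x)}d\varphi(t).$$ *)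

theory Defs
  imports "HOL-Analysis.Analysis"
begin

definition is_cdf :: "(real \<Rightarrow> real) \<Rightarrow> bool" where
  "is_cdf F \<longleftrightarrow> mono F \<and> (\<forall>x. continuous (at_right x) F) \<and>
     (F \<longlongrightarrow> 0) at_bot \<and> (F \<longlongrightarrow> 1) at_top"

definition is_continuous_rv_cdf :: "(real \<Rightarrow> real) \<Rightarrow> bool" where
  "is_continuous_rv_cdf F \<longleftrightarrow> is_cdf F \<and>
     (\<exists>f. (\<forall>t. f t \<ge> 0) \<and> integrable lborel f \<and> (\<forall>x. F x = (LBINT t:{..x}. f t)))"

definition cdf_ext :: "(real \<Rightarrow> real) \<Rightarrow> ereal \<Rightarrow> real" where
  "cdf_ext F x = (case x of ereal r \<Rightarrow> F r | PInfty \<Rightarrow> 1 | MInfty \<Rightarrow> 0)"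

definition integral_d :: "(real \<Rightarrow> real) \<Rightarrow> ereal \<Rightarrow> ereal \<Rightarrow> real" where
  "integral_d F a b = cdf_ext F b - cdf_ext F a"

text \<open>The cube $[0,1]^m$ is the order interval \<open>{0..1}\<close> of \<^typ>\<open>real ^ 'm\<close>, whose order is
  componentwise and whose constants \<open>0\<close> and \<open>1\<close> are the vectors with all entries 0 and all
  entries 1. The points of the cube lying componentwise above \<open>t\<close> form \<open>{t..1}\<close>.
  All functions on the cube are total functions of which only the values on \<open>{0..1}\<close> matter.\<close>

definition right_continuous_cube :: "(real ^ 'm \<Rightarrow> 'b::topological_space) \<Rightarrow> bool" where
  "right_continuous_cube h \<longleftrightarrow> (\<forall>t\<in>{0..1}. (h \<longlongrightarrow> h t) (at t within {t..1}))"

text \<open>Used together with continuity into \<^typ>\<open>ereal\<close>: near a point where \<open>h\<close> is finite, a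
  continuous \<open>h\<close> is finite, so the value of \<^const>\<open>real_of_ereal\<close> at infinity plays no role.\<close>

definition differentiable_where_finite :: "(real ^ 'm \<Rightarrow> ereal) \<Rightarrow> bool" where
  "differentiable_where_finite h \<longleftrightarrow>
     (\<forall>t\<in>{0..1}. \<bar>h t\<bar> \<noteq> \<infinity> \<longrightarrow>
        (\<lambda>s. real_of_ereal (h s)) differentiable (at t within {0..1}))"

definition compatible :: "(real \<Rightarrow> ereal) \<Rightarrow> (real \<Rightarrow> real) \<Rightarrow> bool" where
  "compatible f F \<longleftrightarrow>
     (\<forall>x0 r. f x0 = ereal r \<and> \<not> isCont F r \<longrightarrow>
        isCont f x0 \<and> (\<exists>\<delta>>0. \<forall>x\<in>{x0..<x0 + \<delta>}. f x = f x0))"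

definition at_cdfs :: "(real ^ 'm \<Rightarrow> 'b) \<Rightarrow> ('m \<Rightarrow> real \<Rightarrow> real) \<Rightarrow> real \<Rightarrow> 'b" where
  "at_cdfs h G x = h (\<chi> i. G i x)"

text \<open>The conditions that the two forms have in common. The index type \<open>'m\<close> is finite and, like
  every type, nonempty; only the members with index in \<open>{1..N}\<close> of the families
  \<open>\<mu>, l, \<nu>, m\<close> matter.\<close>

locale generator =
  fixes N :: nat
    and F :: "real \<Rightarrow> real"
    and U \<theta> :: "real ^ 'm::finite \<Rightarrow> real"
    and \<mu> l \<nu> m :: "nat \<Rightarrow> real ^ 'm \<Rightarrow> ereal"
    and G :: "'m \<Rightarrow> real \<Rightarrow> real"
  assumes N_pos: "N \<ge> 1"
    and G_cdf: "\<And>i. is_cdf (G i)"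
    and F_cdf: "is_cdf F"
    and nonneg: "\<And>t. t \<in> {0..1} \<Longrightarrow> U t \<ge> 0 \<and> \<theta> t \<ge> 0"
    and right_cont: "right_continuous_cube U" "right_continuous_cube \<theta>"
      "\<And>j. j \<in> {1..N} \<Longrightarrow> right_continuous_cube (\<mu> j)"
      "\<And>j. j \<in> {1..N} \<Longrightarrow> right_continuous_cube (l j)"
      "\<And>j. j \<in> {1..N} \<Longrightarrow> right_continuous_cube (\<nu> j)"
      "\<And>j. j \<in> {1..N} \<Longrightarrow> right_continuous_cube (m j)"
    and nondecreasing: "mono_on {0..1} U"
      "\<And>j. j \<in> {1..N} \<Longrightarrow> mono_on {0..1} (\<mu> j)"
      "\<And>j. j \<in> {1..N} \<Longrightarrow> mono_on {0..1} (m j)"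
    and nonincreasing: "antimono_on {0..1} \<theta>"
      "\<And>j. j \<in> {1..N} \<Longrightarrow> antimono_on {0..1} (l j)"
      "\<And>j. j \<in> {1..N} \<Longrightarrow> antimono_on {0..1} (\<nu> j)"
    and continuous_or_compatible:
      "(\<forall>x. isCont F x) \<or>
       (\<forall>j\<in>{1..N}. compatible (at_cdfs (l j) G) F \<and> compatible (at_cdfs (\<nu> j) G) F)"
    and cont_at_corner_values:
      "\<And>j h p r. j \<in> {1..N} \<Longrightarrow> h \<in> {l j, \<mu> j, m j, \<nu> j} \<Longrightarrow> p \<in> {0, 1} \<Longrightarrow>
         h p = ereal r \<Longrightarrow> isCont F r"

locale form_A = generator +
  assumes unequal_at_0: "U 0 \<noteq> \<theta> 0 \<Longrightarrow>
      (U 0 = 0 \<or> (\<forall>j\<in>{1..N}. \<mu> j 0 = l j 0)) \<and> (\<theta> 0 = 0 \<or> (\<forall>j\<in>{1..N}. m j 0 = \<nu> j 0))"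
    and equal_at_0: "U 0 = \<theta> 0 \<Longrightarrow> U 0 \<noteq> 0 \<Longrightarrow>
      (\<forall>j\<in>{1..N}. \<mu> j 0 = \<nu> j 0 \<and> m j 0 = l j 0)"
    and l_le_\<mu>: "\<And>j. j \<in> {1..N} \<Longrightarrow> l j 0 \<le> \<mu> j 0"
    and m_le_\<nu>: "\<And>j. \<theta> 0 \<noteq> 0 \<Longrightarrow> j \<in> {1..N} \<Longrightarrow> m j 1 \<le> \<nu> j 1"
    and \<mu>_last: "\<mu> N 1 \<ge> Sup (ereal ` {x. F x < 1})"
    and l_first: "l 1 1 \<le> Inf (ereal ` {x. F x > 0})"
    and U_at_1: "U 1 = 1"
    and \<theta>_at_1: "\<theta> 1 = 0 \<or> (\<forall>j\<in>{1..N}. \<nu> j 1 = m j 1)"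
    and chain: "\<And>j. j \<in> {1..<N} \<Longrightarrow> \<mu> j 1 = l (j + 1) 1"

locale form_B = generator +
  assumes unequal_at_1: "U 1 \<noteq> \<theta> 1 \<Longrightarrow>
      (\<theta> 1 = 0 \<or> (\<forall>j\<in>{1..N}. m j 1 = \<nu> j 1)) \<and> (U 1 = 0 \<or> (\<forall>j\<in>{1..N}. l j 1 = \<mu> j 1))"
    and equal_at_1: "U 1 = \<theta> 1 \<Longrightarrow> U 1 \<noteq> 0 \<Longrightarrow>
      (\<forall>j\<in>{1..N}. \<mu> j 1 = \<nu> j 1 \<and> m j 1 = l j 1)"
    and m_le_\<nu>: "\<And>j. j \<in> {1..N} \<Longrightarrow> m j 1 \<le> \<nu> j 1"
    and l_le_\<mu>: "\<And>j. U 1 \<noteq> 0 \<Longrightarrow> j \<in> {1..N} \<Longrightarrow> l j 0 \<le> \<mu> j 0"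
    and \<nu>_last: "\<nu> N 0 \<ge> Sup (ereal ` {x. F x < 1})"
    and m_first: "m 1 0 \<le> Inf (ereal ` {x. F x > 0})"
    and \<theta>_at_0: "\<theta> 0 = 1"
    and U_at_0: "U 0 = 0 \<or> (\<forall>j\<in>{1..N}. l j 0 = \<mu> j 0)"
    and chain: "\<And>j. j \<in> {1..<N} \<Longrightarrow> \<nu> j 0 = m (j + 1) 0"

definition generated_A ::
  "nat \<Rightarrow> (real \<Rightarrow> real) \<Rightarrow> (real ^ 'm \<Rightarrow> real) \<Rightarrow> (real ^ 'm \<Rightarrow> real) \<Rightarrow>
   (nat \<Rightarrow> real ^ 'm \<Rightarrow> ereal) \<Rightarrow> (nat \<Rightarrow> real ^ 'm \<Rightarrow> ereal) \<Rightarrow>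
   (nat \<Rightarrow> real ^ 'm \<Rightarrow> ereal) \<Rightarrow> (nat \<Rightarrow> real ^ 'm \<Rightarrow> ereal) \<Rightarrow>
   ('m \<Rightarrow> real \<Rightarrow> real) \<Rightarrow> real \<Rightarrow> real" where
  "generated_A N F U \<theta> \<mu> l \<nu> m G x =
     at_cdfs U G x * (\<Sum>j=1..N. integral_d F (at_cdfs (l j) G x) (at_cdfs (\<mu> j) G x))
     - at_cdfs \<theta> G x * (\<Sum>j=1..N. integral_d F (at_cdfs (m j) G x) (at_cdfs (\<nu> j) G x))"

definition generated_B ::
  "nat \<Rightarrow> (real \<Rightarrow> real) \<Rightarrow> (real ^ 'm \<Rightarrow> real) \<Rightarrow> (real ^ 'm \<Rightarrow> real) \<Rightarrow>
   (nat \<Rightarrow> real ^ 'm \<Rightarrow> ereal) \<Rightarrow> (nat \<Rightarrow> real ^ 'm \<Rightarrow> ereal) \<Rightarrow>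
   (nat \<Rightarrow> real ^ 'm \<Rightarrow> ereal) \<Rightarrow> (nat \<Rightarrow> real ^ 'm \<Rightarrow> ereal) \<Rightarrow>
   ('m \<Rightarrow> real \<Rightarrow> real) \<Rightarrow> real \<Rightarrow> real" where
  "generated_B N F U \<theta> \<mu> l \<nu> m G x =
     1 - at_cdfs \<theta> G x * (\<Sum>j=1..N. integral_d F (at_cdfs (m j) G x) (at_cdfs (\<nu> j) G x))
     + at_cdfs U G x * (\<Sum>j=1..N. integral_d F (at_cdfs (l j) G x) (at_cdfs (\<mu> j) G x))"

end

theory Submission
  imports Defs "HOL-Probability.Weak_Convergence"
begin

text \<open>That the generated function is a cdf is checked on the cube, where it is a difference of a
  non-decreasing and a non-increasing product. The density comes from Luzin's property (N): a
  continuous cdf has a density iff it maps null sets to null sets (pull the Lebesgue measure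
  on the unit interval back through the quantile function and apply Radon-Nikodym). A function \<open>k\<close> that
  is differentiable at every point of the cube is pointwise Lipschitz there, and the curve
  \<open>x \<mapsto> (G\<^sub>1 x, \<dots>, G\<^sub>m x)\<close> is Lipschitz in the parameter \<open>\<Sum>i. G\<^sub>i x\<close>, which has property (N); hence
  so has \<open>k (G\<^sub>1 x, \<dots>, G\<^sub>m x)\<close>, and composition with \<open>F\<close> preserves (N). Since the composites are
  monotone, (N) makes them absolutely continuous, a property stable under sums and products,
  which (N) is not.\<close>

section \<open>Luzin's property (N) and densities\<close>

definition luzin_N :: "(real \<Rightarrow> real) \<Rightarrow> bool" where
  "luzin_N \<phi> \<longleftrightarrow> (\<forall>A. negligible A \<longrightarrow> negligible (\<phi> ` A))"

lemma negligible_image_dominated: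
  fixes g \<phi> :: "real \<Rightarrow> real"
  assumes "negligible (g ` S)"
    and dom: "\<And>x. x \<in> S \<Longrightarrow> \<exists>e>0. \<exists>B. \<forall>y\<in>S. \<bar>g y - g x\<bar> < e \<longrightarrow> \<bar>\<phi> y - \<phi> x\<bar> \<le> B * \<bar>g y - g x\<bar>"
  shows "negligible (\<phi> ` S)"
proof -
  define \<psi> where "\<psi> = \<phi> \<circ> inv_into S g"
  have inv: "inv_into S g (g x) \<in> S" "g (inv_into S g (g x)) = g x" if "x \<in> S" for x
    using that by (auto intro: inv_into_into f_inv_into_f)
  have \<psi>: "\<psi> (g x) = \<phi> x" if "x \<in> S" for x
  proof -
    obtain e B where "e > 0"
      and "\<forall>y\<in>S. \<bar>g y - g x\<bar> < e \<longrightarrow> \<bar>\<phi> y - \<phi> x\<bar> \<le> B * \<bar>g y - g x\<bar>"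
      using dom[OF \<open>x \<in> S\<close>] by blast
    \<comment> \<open>Two points with the same \<open>g\<close>-value lie within every radius, so
      the bound forces equal \<open>\<phi>\<close>-values: the choice made by
      \<open>inv_into\<close> does not matter.\<close>
    then have "\<bar>\<phi> (inv_into S g (g x)) - \<phi> x\<bar> \<le> B * \<bar>g x - g x\<bar>"
      using inv[OF \<open>x \<in> S\<close>] by (metis abs_zero diff_self)
    then show ?thesis by (simp add: \<psi>_def)
  qed
  have "negligible (\<psi> ` g ` S)"
  proof (rule negligible_locally_Lipschitz_image)
    fix s assume "s \<in> g ` S"
    then obtain x where x: "x \<in> S" "s = g x" by auto
    obtain e B where "e > 0"
      and B: "\<forall>y\<in>S. \<bar>g y - g x\<bar> < e \<longrightarrow> \<bar>\<phi> y - \<phi> x\<bar> \<le> B * \<bar>g y - g x\<bar>"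
      using dom[OF \<open>x \<in> S\<close>] by blast
    have "\<forall>y\<in>g ` S \<inter> ball s e. norm (\<psi> y - \<psi> s) \<le> B * norm (y - s)"
      using B x by (auto simp: \<psi> dist_real_def abs_minus_commute)
    then show "\<exists>T B. open T \<and> s \<in> T \<and> (\<forall>y\<in>g ` S \<inter> T. norm (\<psi> y - \<psi> s) \<le> B * norm (y - s))"
      using \<open>e > 0\<close> by (intro exI[of _ "ball s e"] exI[of _ B]) auto
  qed (use assms in auto)
  moreover have "\<psi> ` g ` S = \<phi> ` S"
    by (auto simp: \<psi> image_image)
  ultimately show ?thesis by simp
qed

lemma is_cdf_bounds:
  assumes "is_cdf F"
  shows "0 \<le> F x" "F x \<le> 1"
proof -
  have mono: "mono F" and lim: "(F \<longlongrightarrow> 0) at_bot" "(F \<longlongrightarrow> 1) at_top"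
    using assms by (auto simp: is_cdf_def)
  show "0 \<le> F x"
    by (rule tendsto_upperbound[OF lim(1)])
       (use mono in \<open>auto simp: eventually_at_bot_linorder mono_def intro!: exI[of _ x]\<close>)
  show "F x \<le> 1"
    by (rule tendsto_lowerbound[OF lim(2)])
       (use mono in \<open>auto simp: eventually_at_top_linorder mono_def intro!: exI[of _ x]\<close>)
qed

lemma cdf_distribution_is_cdf:
  assumes "is_cdf F"
  shows "cdf_distribution (interval_measure F)" "cdf (interval_measure F) = F"
  using assms real_distribution_interval_measure[of F] cdf_interval_measure[of F]
  by (auto simp: is_cdf_def cdf_distribution_def mono_def)

text \<open>\<open>M\<close> is the image of Lebesgue measure on the open unit interval under the
  quantile function \<open>I\<close>, so \<open>M\<close>-null sets are those with Lebesgue-null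
  preimage under \<open>I\<close>.\<close>

lemma (in cdf_distribution) null_sets_quantile_iff:
  assumes "A \<in> sets borel"
  shows "{u \<in> {0<..<1}. I u \<in> A} \<in> null_sets lborel \<longleftrightarrow> A \<in> null_sets M"
proof -
  let ?V = "{u \<in> {0<..<1}. I u \<in> A}"
  have V: "I -` A \<inter> space (restrict_space borel {0<..<1}) = ?V"
    by (auto simp: space_restrict_space)
  have "?V \<in> sets (restrict_space borel {0<..<1})"
    using measurable_sets[OF measurable_CI assms] V by simp
  then have meas: "?V \<in> sets borel"
    by (simp add: sets_restrict_space_iff)
  have "emeasure M A = emeasure (distr (restrict_space lborel {0<..<1::real}) borel I) A"
    by (simp add: distr_I_eq_M)
  also have "\<dots> = emeasure (restrict_space lborel {0<..<1}) ?V"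
    using V by (subst emeasure_distr) (auto simp: assms space_restrict_space)
  also have "\<dots> = emeasure lborel ?V"
    by (rule emeasure_restrict_space) auto
  finally show ?thesis
    using meas assms by (auto simp: null_sets_def)
qed

lemma negligible_imp_null_borel:
  fixes A :: "real set"
  assumes "negligible A"
  obtains A' where "A' \<in> null_sets lborel" "A \<subseteq> A'"
  using assms by (auto simp: negligible_iff_null_sets null_sets_completion_iff2)

lemma null_borel_imp_negligible:
  fixes A :: "real set"
  assumes "A \<in> null_sets lborel"
  shows "negligible A"
  using assms by (auto simp: negligible_iff_null_sets null_sets_completionI)

text \<open>A null set is null for the measure with density \<open>f\<close>, hence its preimage
  under the quantile function is null. That preimage contains all values of \<open>F\<close> on the
  set, except for 0, 1 and the values on flat pieces of \<open>F\<close>, of which there are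
  countably many.\<close>

lemma luzin_N_continuous_rv_cdf:
  assumes "is_continuous_rv_cdf F"
  shows "luzin_N F"
  unfolding luzin_N_def
proof (intro allI impI)
  fix A :: "real set" assume "negligible A"
  then obtain A' where A': "A' \<in> null_sets lborel" "A \<subseteq> A'"
    by (rule negligible_imp_null_borel)
  have cdf: "is_cdf F" using assms by (simp add: is_continuous_rv_cdf_def)
  obtain f where f: "\<And>t. f t \<ge> 0" "integrable lborel f" "\<And>x. F x = (LBINT t:{..x}. f t)"
    using assms by (auto simp: is_continuous_rv_cdf_def)
  define M where "M = interval_measure F"
  interpret cdf_distribution M
    unfolding M_def by (rule cdf_distribution_is_cdf[OF cdf])
  have cdfM: "cdf M = F"
    unfolding M_def by (rule cdf_distribution_is_cdf[OF cdf])
  let ?D = "density lborel (\<lambda>t. ennreal (f t))"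
  have em: "emeasure ?D X = ennreal (LBINT t:X. f t)" if "X \<in> sets borel" for X
  proof -
    have "emeasure ?D X = (\<integral>\<^sup>+t. ennreal (f t) * indicator X t \<partial>lborel)"
      using that f(2) by (subst emeasure_density) auto
    also have "\<dots> = (\<integral>\<^sup>+t. ennreal (indicator X t *\<^sub>R f t) \<partial>lborel)"
      by (intro nn_integral_cong) (auto split: split_indicator)
    also have "\<dots> = ennreal (LBINT t:X. f t)"
      unfolding set_lebesgue_integral_def using that f
      by (subst nn_integral_eq_integral) (auto intro!: integrable_mult_indicator AE_I2 scaleR_nonneg_nonneg simp del: real_scaleR_def)
    finally show ?thesis .
  qed
  have "finite_measure ?D"
    by (rule finite_measureI) (use em[of UNIV] in simp)
  then have D: "finite_borel_measure ?D"
    by (simp add: finite_borel_measure_def finite_borel_measure_axioms_def)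
  \<comment> \<open>Finite Borel measures on the line are determined by their cdfs.\<close>
  have "M = ?D"
  proof (rule cdf_unique')
    show "cdf M = cdf ?D"
    proof
      fix x
      have "cdf ?D x = F x"
        using is_cdf_bounds(1)[OF cdf, of x] by (simp add: cdf_def measure_def em f(3))
      then show "cdf M x = cdf ?D x" by (simp add: cdfM)
    qed
  qed (use D finite_borel_measure_M in auto)
  then have "A' \<in> null_sets M"
    using A'(1) absolutely_continuousI_density[of "\<lambda>t. ennreal (f t)" lborel] f(2)
    by (auto simp: absolutely_continuous_def)
  then have null: "{u \<in> {0<..<1}. I u \<in> A'} \<in> null_sets lborel"
    by (subst null_sets_quantile_iff) auto
  \<comment> \<open>If \<open>u = F x\<close> is strictly between 0 and 1 and \<open>I u\<close>
    differs from \<open>x\<close>, then \<open>I u < x\<close> and \<open>F\<close> is constantly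
    \<open>u\<close> from \<open>I u\<close> to \<open>x\<close>, so \<open>u\<close> is also
    attained at a rational.\<close>
  have "F ` A \<subseteq> {u \<in> {0<..<1}. I u \<in> A'} \<union> ({0, 1} \<union> F ` \<rat>)"
  proof
    fix u assume "u \<in> F ` A"
    then obtain x where x: "x \<in> A" "u = F x" by auto
    show "u \<in> {u \<in> {0<..<1}. I u \<in> A'} \<union> ({0, 1} \<union> F ` \<rat>)"
    proof (cases "u \<in> {0, 1} \<or> I u = x")
      case True
      then show ?thesis using x A' is_cdf_bounds[OF cdf, of x] by auto
    next
      case False
      then have u: "0 < u" "u < 1" using is_cdf_bounds[OF cdf, of x] x by auto
      have le: "I u \<le> x" "u \<le> F (I u)"
        using pseudoinverse[OF u, of x] pseudoinverse[OF u, of "I u"] x unfolding cdfM by auto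
      then obtain q where q: "q \<in> \<rat>" "I u < q" "q < x"
        using Rats_dense_in_real[of "I u" x] False by auto
      have "F q = u"
        using q le x monoD[OF mono, of "I u" q] monoD[OF mono, of q x] cdfM by auto
      then show ?thesis using q by auto
    qed
  qed
  moreover have "negligible ({0, 1} \<union> F ` \<rat>)"
    by (intro null_borel_imp_negligible countable_imp_null_set_lborel) (auto simp: countable_rat)
  ultimately show "negligible (F ` A)"
    using null_borel_imp_negligible[OF null] negligible_Un negligible_subset by blast
qed

lemma continuous_rv_cdf_luzin_N:
  assumes cdf: "is_cdf F" and F_cont: "\<And>x. isCont F x" and "luzin_N F"
  shows "is_continuous_rv_cdf F"
proof -
  define M where "M = interval_measure F"
  interpret cdf_distribution M
    unfolding M_def by (rule cdf_distribution_is_cdf[OF cdf])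
  have cdfM: "cdf M = F"
    unfolding M_def by (rule cdf_distribution_is_cdf[OF cdf])
  have FI: "F (I u) = u" if u: "0 < u" "u < 1" for u
  proof (rule antisym)
    show "u \<le> F (I u)"
      using pseudoinverse[OF u, of "I u"] unfolding cdfM by blast
    \<comment> \<open>Left of \<open>I u\<close> the cdf stays below \<open>u\<close>; left
      continuity carries the bound to \<open>I u\<close> itself, which rules out a jump over
      \<open>u\<close>.\<close>
    have "F x < u" if "x < I u" for x
      using pseudoinverse[OF u, of x] that unfolding cdfM by linarith
    then have "eventually (\<lambda>x. F x \<le> u) (at_left (I u))"
      by (auto simp: eventually_at_left_field intro!: exI[of _ "I u - 1"] less_imp_le)
    moreover have "(F \<longlongrightarrow> F (I u)) (at_left (I u))"
      using F_cont[of "I u"] by (simp add: continuous_at filterlim_at_split)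
    ultimately show "F (I u) \<le> u"
      by (intro tendsto_upperbound) auto
  qed
  have "absolutely_continuous lborel M"
    unfolding absolutely_continuous_def
  proof
    fix A :: "real set" assume A: "A \<in> null_sets lborel"
    then have borel: "A \<in> sets borel" by auto
    have "{u \<in> {0<..<1}. I u \<in> A} \<subseteq> F ` A"
      using FI by force
    then have "negligible {u \<in> {0<..<1}. I u \<in> A}"
      using \<open>luzin_N F\<close> null_borel_imp_negligible[OF A] negligible_subset
      unfolding luzin_N_def by blast
    moreover have "{u \<in> {0<..<1}. I u \<in> A} \<in> sets borel"
    proof -
      have "I -` A \<inter> space (restrict_space borel {0<..<1}) = {u \<in> {0<..<1}. I u \<in> A}"
        by (auto simp: space_restrict_space)
      then show ?thesis
        using measurable_sets[OF measurable_CI borel] by (simp add: sets_restrict_space_iff)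
    qed
    ultimately have "{u \<in> {0<..<1}. I u \<in> A} \<in> null_sets lborel"
      by (auto simp: negligible_iff_null_sets null_sets_def)
    then show "A \<in> null_sets M"
      using null_sets_quantile_iff[OF borel] by simp
  qed
  then obtain f0 where f0: "f0 \<in> borel_measurable lborel" "density lborel f0 = M"
    using sigma_finite_measure.Radon_Nikodym[OF sigma_finite_lborel, of M] by auto
  have int1: "(\<integral>\<^sup>+t. f0 t \<partial>lborel) = 1"
  proof -
    have "(\<integral>\<^sup>+t. f0 t \<partial>lborel) = emeasure (density lborel f0) UNIV"
      using f0(1) by (subst emeasure_density) auto
    then show ?thesis using f0(2) emeasure_space_1 by simp
  qed
  \<comment> \<open>\<open>enn2real\<close> sends infinity to 0. As \<open>f0\<close> has total
    integral 1, it is finite almost everywhere, so only a null set is affected.\<close>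
  define f where "f t = enn2real (f0 t)" for t
  have f_nonneg: "0 \<le> f t" for t by (simp add: f_def)
  have f_meas: "f \<in> borel_measurable lborel"
    unfolding f_def using f0 by measurable
  have AE: "AE t in lborel. ennreal (f t) = f0 t"
  proof -
    have "AE t in lborel. f0 t \<noteq> \<infinity>"
      using f0 int1 by (intro nn_integral_PInf_AE) auto
    then show ?thesis by eventually_elim (auto simp: f_def less_top)
  qed
  have int: "integrable lborel f"
  proof (rule integrableI_nonneg)
    have "(\<integral>\<^sup>+t. ennreal (f t) \<partial>lborel) = 1"
      using nn_integral_cong_AE[OF AE] int1 by simp
    then show "(\<integral>\<^sup>+t. ennreal (f t) \<partial>lborel) < \<infinity>" by simp
  qed (use f_meas in \<open>auto simp: f_def\<close>)
  have "F x = (LBINT t:{..x}. f t)" for x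
  proof -
    have "ennreal (F x) = emeasure M {..x}"
      using cdfM by (metis cdf_def emeasure_eq_measure)
    also have "\<dots> = (\<integral>\<^sup>+t. f0 t * indicator {..x} t \<partial>lborel)"
      using f0 by (subst f0(2)[symmetric], subst emeasure_density) auto
    also have "\<dots> = (\<integral>\<^sup>+t. ennreal (indicator {..x} t *\<^sub>R f t) \<partial>lborel)"
      by (intro nn_integral_cong_AE) (use AE in \<open>eventually_elim, auto split: split_indicator\<close>)
    also have "\<dots> = ennreal (LBINT t:{..x}. f t)"
      unfolding set_lebesgue_integral_def using int f_nonneg
      by (subst nn_integral_eq_integral) (auto intro!: integrable_mult_indicator AE_I2 scaleR_nonneg_nonneg simp del: real_scaleR_def)
    finally show ?thesis
      using is_cdf_bounds[OF cdf, of x]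
      by (subst (asm) ennreal_inj) (auto simp: set_lebesgue_integral_def f_def intro!: integral_nonneg_AE)
  qed
  then show ?thesis
    using cdf int unfolding is_continuous_rv_cdf_def
    by (intro conjI exI[of _ f]) (auto simp: f_nonneg)
qed

section \<open>Absolute continuity\<close>

text \<open>The density lives on the whole line, so these functions are bounded, and products stay in
  the class.\<close>

definition abs_cont :: "(real \<Rightarrow> real) \<Rightarrow> bool" where
  "abs_cont \<phi> \<longleftrightarrow> (\<exists>f. (\<forall>t. 0 \<le> f t) \<and> integrable lborel f \<and>
     (\<forall>x y. x \<le> y \<longrightarrow> \<bar>\<phi> y - \<phi> x\<bar> \<le> (LBINT t:{..y}. f t) - (LBINT t:{..x}. f t)))"

lemma abs_contI:
  assumes "\<And>t. 0 \<le> f t" "integrable lborel f"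
    "\<And>x y. x \<le> y \<Longrightarrow> \<bar>\<phi> y - \<phi> x\<bar> \<le> (LBINT t:{..y}. f t) - (LBINT t:{..x}. f t)"
  shows "abs_cont \<phi>"
  using assms unfolding abs_cont_def by blast

lemma abs_contE:
  assumes "abs_cont \<phi>"
  obtains f where "\<And>t. 0 \<le> f t" "integrable lborel f"
    "\<And>x y. x \<le> y \<Longrightarrow> \<bar>\<phi> y - \<phi> x\<bar> \<le> (LBINT t:{..y}. f t) - (LBINT t:{..x}. f t)"
  using assms unfolding abs_cont_def by blast

lemma set_integrable_Iic:
  fixes f :: "real \<Rightarrow> real"
  assumes "integrable lborel f"
  shows "set_integrable lborel {..x} f"
  using assms unfolding set_integrable_def by (intro integrable_mult_indicator) auto

lemma integral_Iic_mono:
  fixes f :: "real \<Rightarrow> real"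
  assumes "\<And>t. 0 \<le> f t" "integrable lborel f" "x \<le> y"
  shows "(LBINT t:{..x}. f t) \<le> (LBINT t:{..y}. f t)"
  unfolding set_lebesgue_integral_def
  using assms set_integrable_Iic[OF assms(2)] unfolding set_integrable_def
  by (intro integral_mono) (auto split: split_indicator)

lemma integral_Iic_bounds:
  fixes f :: "real \<Rightarrow> real"
  assumes "\<And>t. 0 \<le> f t" "integrable lborel f"
  shows "0 \<le> (LBINT t:{..x}. f t)" "(LBINT t:{..x}. f t) \<le> integral\<^sup>L lborel f"
  unfolding set_lebesgue_integral_def
  using assms set_integrable_Iic[OF assms(2)] unfolding set_integrable_def
  by (auto intro!: integral_mono integral_nonneg_AE split: split_indicator)

text \<open>The increment between any point and 0 is at most the total integral of the majorant
  \<open>f\<close>.\<close>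

lemma abs_cont_bounded:
  assumes "abs_cont \<phi>"
  obtains B where "\<And>x. \<bar>\<phi> x\<bar> \<le> B"
proof -
  obtain f where f: "\<And>t. 0 \<le> f t" "integrable lborel f"
    "\<And>x y. x \<le> y \<Longrightarrow> \<bar>\<phi> y - \<phi> x\<bar> \<le> (LBINT t:{..y}. f t) - (LBINT t:{..x}. f t)"
    using assms by (rule abs_contE) blast
  have "\<bar>\<phi> x\<bar> \<le> \<bar>\<phi> 0\<bar> + integral\<^sup>L lborel f" for x
    using f(3)[of x 0] f(3)[of 0 x] integral_Iic_bounds[OF f(1,2), of x] integral_Iic_bounds[OF f(1,2), of 0]
    by linarith
  then show ?thesis by (rule that)
qed

lemma integral_Iic_lincomb:
  fixes f g :: "real \<Rightarrow> real"
  assumes "integrable lborel f" "integrable lborel g"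
  shows "(LBINT t:{..x}. a * f t + b * g t) = a * (LBINT t:{..x}. f t) + b * (LBINT t:{..x}. g t)"
  using set_integrable_Iic[OF assms(1), of x] set_integrable_Iic[OF assms(2), of x]
  by (simp add: set_integral_add)

text \<open>The combination \<open>a * f + b * g\<close> of the two majorants is a majorant for
  \<open>\<xi>\<close>. Closure under sums, differences and products all reduce to this.\<close>

lemma abs_cont_lincomb_bound:
  assumes \<phi>: "abs_cont \<phi>" and \<psi>: "abs_cont \<psi>" and ab: "0 \<le> a" "0 \<le> b"
    and bound: "\<And>x y. x \<le> y \<Longrightarrow> \<bar>\<xi> y - \<xi> x\<bar> \<le> a * \<bar>\<phi> y - \<phi> x\<bar> + b * \<bar>\<psi> y - \<psi> x\<bar>"
  shows "abs_cont \<xi>"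
proof -
  obtain f where f: "\<And>t. 0 \<le> f t" "integrable lborel f"
    "\<And>x y. x \<le> y \<Longrightarrow> \<bar>\<phi> y - \<phi> x\<bar> \<le> (LBINT t:{..y}. f t) - (LBINT t:{..x}. f t)"
    using \<phi> by (rule abs_contE) blast
  obtain g where g: "\<And>t. 0 \<le> g t" "integrable lborel g"
    "\<And>x y. x \<le> y \<Longrightarrow> \<bar>\<psi> y - \<psi> x\<bar> \<le> (LBINT t:{..y}. g t) - (LBINT t:{..x}. g t)"
    using \<psi> by (rule abs_contE) blast
  show ?thesis
  proof (rule abs_contI)
    fix x y :: real assume xy: "x \<le> y"
    have "\<bar>\<xi> y - \<xi> x\<bar> \<le> a * \<bar>\<phi> y - \<phi> x\<bar> + b * \<bar>\<psi> y - \<psi> x\<bar>"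
      using bound[OF xy] .
    also have "\<dots> \<le> a * ((LBINT t:{..y}. f t) - (LBINT t:{..x}. f t)) +
        b * ((LBINT t:{..y}. g t) - (LBINT t:{..x}. g t))"
      by (intro add_mono mult_left_mono f(3) g(3) xy ab)
    also have "\<dots> = (LBINT t:{..y}. a * f t + b * g t) - (LBINT t:{..x}. a * f t + b * g t)"
      using f(2) g(2) by (simp add: integral_Iic_lincomb algebra_simps)
    finally show "\<bar>\<xi> y - \<xi> x\<bar> \<le> (LBINT t:{..y}. a * f t + b * g t) - (LBINT t:{..x}. a * f t + b * g t)" .
  qed (use f g ab in auto)
qed

lemma abs_cont_const: "abs_cont (\<lambda>_. c)"
  by (rule abs_contI[of "\<lambda>_. 0"]) auto

lemma abs_cont_add:
  assumes "abs_cont \<phi>" "abs_cont \<psi>"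
  shows "abs_cont (\<lambda>x. \<phi> x + \<psi> x)"
  by (rule abs_cont_lincomb_bound[OF assms, of 1 1]) auto

lemma abs_cont_diff:
  assumes "abs_cont \<phi>" "abs_cont \<psi>"
  shows "abs_cont (\<lambda>x. \<phi> x - \<psi> x)"
  by (rule abs_cont_lincomb_bound[OF assms, of 1 1]) auto

lemma abs_cont_sum:
  assumes "\<And>i. i \<in> I \<Longrightarrow> abs_cont (\<phi> i)"
  shows "abs_cont (\<lambda>x. \<Sum>i\<in>I. \<phi> i x)"
  using assms by (induction I rule: infinite_finite_induct) (auto intro: abs_cont_const abs_cont_add)

lemma abs_cont_mult:
  assumes "abs_cont \<phi>" "abs_cont \<psi>"
  shows "abs_cont (\<lambda>x. \<phi> x * \<psi> x)"
proof -
  obtain B where B: "\<And>x. \<bar>\<phi> x\<bar> \<le> B" using assms(1) by (rule abs_cont_bounded) blast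
  obtain C where C: "\<And>x. \<bar>\<psi> x\<bar> \<le> C" using assms(2) by (rule abs_cont_bounded) blast
  show ?thesis
  proof (rule abs_cont_lincomb_bound[OF assms])
    show "0 \<le> C" "0 \<le> B" using B[of 0] C[of 0] by linarith+
    fix x y :: real
    \<comment> \<open>The discrete product rule: each increment is multiplied by a value of the
      other factor, and those values are bounded.\<close>
    have "\<phi> y * \<psi> y - \<phi> x * \<psi> x = (\<phi> y - \<phi> x) * \<psi> y + \<phi> x * (\<psi> y - \<psi> x)"
      by (simp add: algebra_simps)
    then have "\<bar>\<phi> y * \<psi> y - \<phi> x * \<psi> x\<bar> \<le> \<bar>\<phi> y - \<phi> x\<bar> * \<bar>\<psi> y\<bar> + \<bar>\<phi> x\<bar> * \<bar>\<psi> y - \<psi> x\<bar>"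
      by (metis abs_mult abs_triangle_ineq)
    also have "\<dots> \<le> \<bar>\<phi> y - \<phi> x\<bar> * C + B * \<bar>\<psi> y - \<psi> x\<bar>"
      by (intro add_mono mult_left_mono mult_right_mono B C) auto
    finally show "\<bar>\<phi> y * \<psi> y - \<phi> x * \<psi> x\<bar> \<le> C * \<bar>\<phi> y - \<phi> x\<bar> + B * \<bar>\<psi> y - \<psi> x\<bar>"
      by (simp add: mult.commute)
  qed
qed

lemma abs_cont_continuous_rv_cdf:
  assumes "is_continuous_rv_cdf F"
  shows "abs_cont F"
proof -
  obtain f where "\<And>t. f t \<ge> 0" "integrable lborel f" "\<And>x. F x = (LBINT t:{..x}. f t)"
    using assms by (auto simp: is_continuous_rv_cdf_def)
  then show ?thesis
    by (intro abs_contI[of f]) (auto simp: integral_Iic_mono)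
qed

section \<open>Limits and continuity of indefinite integrals, and normalization to a cdf\<close>

lemma tendsto_integral_Iic_at_top:
  fixes f :: "real \<Rightarrow> real"
  assumes "integrable lborel f"
  shows "((\<lambda>x. LBINT t:{..x}. f t) \<longlongrightarrow> integral\<^sup>L lborel f) at_top"
  using tendsto_integral_at_top[of lborel f] assms
  by (simp add: set_lebesgue_integral_def)

lemma tendsto_integral_Iic_at_bot:
  fixes f :: "real \<Rightarrow> real"
  assumes "integrable lborel f"
  shows "((\<lambda>x. LBINT t:{..x}. f t) \<longlongrightarrow> 0) at_bot"
proof (rule tendsto_at_botI_sequentially)
  fix X :: "nat \<Rightarrow> real" assume X: "filterlim X at_bot sequentially"
  have "(\<lambda>n. LBINT t. indicator {..X n} t *\<^sub>R f t) \<longlonglongrightarrow> integral\<^sup>L lborel (\<lambda>t::real. 0::real)"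
  proof (rule integral_dominated_convergence[where w="\<lambda>t. \<bar>f t\<bar>"])
    show "AE t in lborel. (\<lambda>n. indicator {..X n} t *\<^sub>R f t) \<longlonglongrightarrow> 0"
    proof (intro AE_I2 tendsto_eventually)
      fix t
      have "eventually (\<lambda>n. X n < t) sequentially"
        using X by (simp add: filterlim_at_bot_dense)
      then show "eventually (\<lambda>n. indicator {..X n} t *\<^sub>R f t = 0) sequentially"
        by eventually_elim auto
    qed
  qed (use assms in \<open>auto split: split_indicator\<close>)
  then show "(\<lambda>n. LBINT t:{..X n}. f t) \<longlonglongrightarrow> 0"
    by (simp add: set_lebesgue_integral_def)
qed

text \<open>Dominated convergence with \<open>\<bar>f t\<bar>\<close> as dominating function: along
  a sequence tending to \<open>a\<close> the indicators are eventually constant at every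
  \<open>t\<close> other than \<open>a\<close>, and a single point is null.\<close>

lemma isCont_integral_Iic:
  fixes f :: "real \<Rightarrow> real"
  assumes "integrable lborel f"
  shows "isCont (\<lambda>x. LBINT t:{..x}. f t) a"
proof -
  have "((\<lambda>x. LBINT t. indicator {..x} t *\<^sub>R f t) \<longlongrightarrow> (LBINT t. indicator {..a} t *\<^sub>R f t)) (at a)"
  proof (rule tendsto_at_iff_sequentially[THEN iffD2], safe)
    fix X :: "nat \<Rightarrow> real" assume X: "X \<longlonglongrightarrow> a"
    show "((\<lambda>x. LBINT t. indicator {..x} t *\<^sub>R f t) \<circ> X) \<longlonglongrightarrow> (LBINT t. indicator {..a} t *\<^sub>R f t)"
      unfolding comp_def
    proof (rule integral_dominated_convergence[where w="\<lambda>t. \<bar>f t\<bar>"])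
      show "AE t in lborel. (\<lambda>n. indicator {..X n} t *\<^sub>R f t) \<longlonglongrightarrow> indicator {..a} t *\<^sub>R f t"
        using AE_lborel_singleton[of a]
      proof eventually_elim
        case (elim t)
        show ?case
        proof (rule tendsto_eventually)
          show "eventually (\<lambda>n. indicator {..X n} t *\<^sub>R f t = indicator {..a} t *\<^sub>R f t) sequentially"
          proof (cases "t < a")
            case True
            show ?thesis using order_tendstoD(1)[OF X True] by eventually_elim (use True in auto)
          next
            case False
            then have "a < t" using elim by auto
            show ?thesis using order_tendstoD(2)[OF X \<open>a < t\<close>] by eventually_elim (use \<open>a < t\<close> in auto)
          qed
        qed
      qed
    qed (use assms in \<open>auto split: split_indicator\<close>)
  qed
  then show ?thesis by (simp add: continuous_at set_lebesgue_integral_def)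
qed

text \<open>The affine change of scale through which facts about cdfs reach bounded monotone
  functions.\<close>

lemma is_cdf_normalized:
  fixes \<phi> :: "real \<Rightarrow> real"
  assumes "mono \<phi>" "\<And>x. isCont \<phi> x" "(\<phi> \<longlongrightarrow> a) at_bot" "(\<phi> \<longlongrightarrow> b) at_top" "a < b"
  shows "is_cdf (\<lambda>x. (\<phi> x - a) / (b - a))"
  unfolding is_cdf_def
proof (intro conjI allI)
  show "mono (\<lambda>x. (\<phi> x - a) / (b - a))"
    using assms(1,5) by (auto simp: mono_def intro!: divide_right_mono)
  show "continuous (at_right x) (\<lambda>x. (\<phi> x - a) / (b - a))" for x
  proof (rule continuous_at_imp_continuous_at_within)
    show "isCont (\<lambda>x. (\<phi> x - a) / (b - a)) x"
      using assms(5) by (intro isCont_divide isCont_diff assms(2) continuous_const) simp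
  qed
  have "((\<lambda>x. (\<phi> x - a) / (b - a)) \<longlongrightarrow> (a - a) / (b - a)) at_bot"
    using assms by (intro tendsto_intros) auto
  then show "((\<lambda>x. (\<phi> x - a) / (b - a)) \<longlongrightarrow> 0) at_bot" by simp
  have "((\<lambda>x. (\<phi> x - a) / (b - a)) \<longlongrightarrow> (b - a) / (b - a)) at_top"
    using assms by (intro tendsto_intros) auto
  then show "((\<lambda>x. (\<phi> x - a) / (b - a)) \<longlongrightarrow> 1) at_top" using assms(5) by simp
qed

text \<open>Divided by its total mass \<open>b\<close>, the integral of the majorant becomes a cdf
  with density, which has (N). The increments of \<open>\<phi>\<close> are at most \<open>b\<close>
  times those of this cdf, so (N) passes to \<open>\<phi>\<close>. For total mass 0 the function is
  constant.\<close>

lemma luzin_N_abs_cont: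
  assumes "abs_cont \<phi>"
  shows "luzin_N \<phi>"
  unfolding luzin_N_def
proof (intro allI impI)
  fix A :: "real set" assume A: "negligible A"
  obtain f where f: "\<And>t. 0 \<le> f t" "integrable lborel f"
    and bound: "\<And>x y. x \<le> y \<Longrightarrow> \<bar>\<phi> y - \<phi> x\<bar> \<le> (LBINT t:{..y}. f t) - (LBINT t:{..x}. f t)"
    using assms by (rule abs_contE) blast
  have c: "0 < integral\<^sup>L lborel f \<or> integral\<^sup>L lborel f = 0"
    using f by (metis integral_nonneg_AE AE_I2 less_eq_real_def)
  show "negligible (\<phi> ` A)"
  proof (cases "integral\<^sup>L lborel f = 0")
    case True
    then have z: "(LBINT t:{..x}. f t) = 0" for x
      using integral_Iic_bounds[OF f, of x] by simp
    have "\<phi> x = \<phi> 0" for x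
      using bound[of x 0] bound[of 0 x] unfolding z by linarith
    then have "\<phi> ` A \<subseteq> {\<phi> 0}" by auto
    then show ?thesis by (meson negligible_sing negligible_subset)
  next
    case False
    define b where "b = integral\<^sup>L lborel f"
    have b: "0 < b" using False c by (auto simp: b_def)
    define K where "K x = (LBINT t:{..x}. f t)" for x
    have "is_cdf (\<lambda>x. (K x - 0) / (b - 0))"
      using b f unfolding K_def b_def
      by (intro is_cdf_normalized tendsto_integral_Iic_at_bot tendsto_integral_Iic_at_top
           isCont_integral_Iic) (auto simp: mono_def integral_Iic_mono)
    moreover have "(K x - 0) / (b - 0) = (LBINT t:{..x}. f t / b)" for x
      by (simp add: K_def)
    ultimately have "is_continuous_rv_cdf (\<lambda>x. (K x - 0) / (b - 0))"
      using f b unfolding is_continuous_rv_cdf_def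
      by (intro conjI exI[of _ "\<lambda>t. f t / b"]) auto
    then have "negligible ((\<lambda>x. (K x - 0) / (b - 0)) ` A)"
      using luzin_N_continuous_rv_cdf A unfolding luzin_N_def by blast
    then show ?thesis
    proof (rule negligible_image_dominated)
      fix x
      have "\<bar>\<phi> y - \<phi> x\<bar> \<le> b * \<bar>(K y - 0) / (b - 0) - (K x - 0) / (b - 0)\<bar>" for y
      proof -
        have "b * \<bar>(K y - 0) / (b - 0) - (K x - 0) / (b - 0)\<bar> = \<bar>K y - K x\<bar>"
          using b by (simp add: diff_divide_distrib[symmetric])
        moreover have "\<bar>\<phi> y - \<phi> x\<bar> \<le> \<bar>K y - K x\<bar>"
          using bound[of x y] bound[of y x] unfolding K_def by linarith
        ultimately show ?thesis by simp
      qed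
      then show "\<exists>e>0. \<exists>B. \<forall>y\<in>A. \<bar>(K y - 0) / (b - 0) - (K x - 0) / (b - 0)\<bar> < e \<longrightarrow>
          \<bar>\<phi> y - \<phi> x\<bar> \<le> B * \<bar>(K y - 0) / (b - 0) - (K x - 0) / (b - 0)\<bar>"
        by (intro exI[of _ 1] conjI exI[of _ b]) auto
    qed
  qed
qed

lemma isCont_abs_cont:
  assumes "abs_cont \<phi>"
  shows "isCont \<phi> a"
proof -
  obtain f where f: "\<And>t. 0 \<le> f t" "integrable lborel f"
    and bound: "\<And>x y. x \<le> y \<Longrightarrow> \<bar>\<phi> y - \<phi> x\<bar> \<le> (LBINT t:{..y}. f t) - (LBINT t:{..x}. f t)"
    using assms by (rule abs_contE) blast
  have "((\<lambda>x. (LBINT t:{..x}. f t) - (LBINT t:{..a}. f t)) \<longlongrightarrow> 0) (at a)"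
    using isCont_integral_Iic[OF f(2), of a] by (simp add: continuous_at LIM_zero)
  then have "((\<lambda>x. \<phi> x - \<phi> a) \<longlongrightarrow> 0) (at a)"
  proof (rule Lim_null_comparison[rotated, OF tendsto_rabs_zero])
    show "\<forall>\<^sub>F x in at a. norm (\<phi> x - \<phi> a) \<le> \<bar>(LBINT t:{..x}. f t) - (LBINT t:{..a}. f t)\<bar>"
    proof (rule always_eventually, rule allI)
      fix x
      show "norm (\<phi> x - \<phi> a) \<le> \<bar>(LBINT t:{..x}. f t) - (LBINT t:{..a}. f t)\<bar>"
        using bound[of x a] bound[of a x] by (simp add: abs_le_iff) linarith
    qed
  qed
  then show ?thesis by (simp add: continuous_at LIM_zero_iff)
qed

text \<open>An absolutely continuous cdf is continuous and has (N), hence has a density. The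
  existence of a density can thus be checked in a class closed under sums and products.\<close>

lemma is_continuous_rv_cdf_iff_abs_cont:
  "is_continuous_rv_cdf F \<longleftrightarrow> is_cdf F \<and> abs_cont F"
  using abs_cont_continuous_rv_cdf continuous_rv_cdf_luzin_N isCont_abs_cont luzin_N_abs_cont
  by (auto simp: is_continuous_rv_cdf_def)

text \<open>Unless \<open>\<phi>\<close> is constant, rescaling its range to the unit interval gives
  a continuous cdf that still has (N), hence a density; undoing the scaling keeps absolute
  continuity.\<close>

lemma abs_cont_mono:
  assumes "mono \<phi>" "\<And>x. isCont \<phi> x" "luzin_N \<phi>" "(\<phi> \<longlongrightarrow> a) at_bot" "(\<phi> \<longlongrightarrow> b) at_top"
  shows "abs_cont \<phi>"
proof -
  have ab: "a \<le> \<phi> x" "\<phi> x \<le> b" for x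
    by (rule tendsto_upperbound[OF assms(4)] tendsto_lowerbound[OF assms(5)];
        use assms(1) in \<open>auto simp: eventually_at_bot_linorder eventually_at_top_linorder mono_def
          intro!: exI[of _ x]\<close>)+
  show ?thesis
  proof (cases "a < b")
    case False
    have "\<phi> x = a" for x using False ab[of x] by linarith
    then have "\<phi> = (\<lambda>_. a)" by (rule ext)
    then show ?thesis by (simp add: abs_cont_const)
  next
    case True
    define C where "C x = (\<phi> x - a) / (b - a)" for x
    have "is_cdf C"
      unfolding C_def using assms True by (intro is_cdf_normalized)
    moreover have "isCont C x" for x
      unfolding C_def using assms(2) True by (intro continuous_intros) auto
    moreover have "luzin_N C"
      unfolding luzin_N_def
    proof (intro allI impI)
      fix A :: "real set" assume "negligible A"
      then have "negligible (\<phi> ` A)" using assms(3) by (auto simp: luzin_N_def)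
      then show "negligible (C ` A)"
      proof (rule negligible_image_dominated)
        fix x
        have "\<bar>C y - C x\<bar> \<le> (1 / (b - a)) * \<bar>\<phi> y - \<phi> x\<bar>" for y
          using True by (simp add: C_def diff_divide_distrib[symmetric])
        then show "\<exists>e>0. \<exists>B. \<forall>y\<in>A. \<bar>\<phi> y - \<phi> x\<bar> < e \<longrightarrow> \<bar>C y - C x\<bar> \<le> B * \<bar>\<phi> y - \<phi> x\<bar>"
          by (intro exI[of _ 1] conjI exI[of _ "1 / (b - a)"]) auto
      qed
    qed
    ultimately have "abs_cont C"
      using continuous_rv_cdf_luzin_N abs_cont_continuous_rv_cdf by blast
    then have "abs_cont (\<lambda>x. a + (b - a) * C x)"
      by (intro abs_cont_add abs_cont_mult abs_cont_const)
    moreover have "a + (b - a) * C x = \<phi> x" for x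
      using True by (simp add: C_def)
    ultimately show ?thesis by simp
  qed
qed

section \<open>Functions on the cube evaluated at cdfs\<close>

lemma luzin_N_uminus:
  assumes "luzin_N \<phi>"
  shows "luzin_N (\<lambda>x. - \<phi> x)"
  unfolding luzin_N_def
proof (intro allI impI)
  fix A :: "real set" assume "negligible A"
  then have "negligible (\<phi> ` A)" using assms by (auto simp: luzin_N_def)
  then show "negligible ((\<lambda>x. - \<phi> x) ` A)"
    by (rule negligible_image_dominated) (auto intro!: exI[of _ 1])
qed

section \<open>Extension of a cdf to the extended reals\<close>

lemma mono_cdf_ext:
  assumes "is_cdf F"
  shows "mono (cdf_ext F)"
proof (rule monoI)
  fix x y :: ereal assume "x \<le> y"
  then show "cdf_ext F x \<le> cdf_ext F y"
    using assms is_cdf_bounds[OF assms]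
    by (cases x; cases y) (auto simp: cdf_ext_def is_cdf_def mono_def)
qed

text \<open>Near a finite point the extension is \<open>F\<close> after
  \<open>real_of_ereal\<close>; at the two infinite points continuity is exactly the limit condition
  on a cdf.\<close>

lemma continuous_cdf_ext:
  assumes cdf: "is_cdf F" and F: "\<And>x. isCont F x"
  shows "continuous_on UNIV (cdf_ext F)"
proof -
  have "isCont (cdf_ext F) x" for x
  proof (cases x)
    case (real r)
    have "isCont (F \<circ> real_of_ereal) (ereal r)"
      unfolding comp_def using F by (intro isCont_o2[OF continuous_at_of_ereal]) auto
    moreover have "eventually (\<lambda>y. y \<in> {-\<infinity><..<\<infinity>}) (nhds (ereal r))"
      by (rule eventually_nhds_in_open) auto
    then have "eventually (\<lambda>y. cdf_ext F y = (F \<circ> real_of_ereal) y) (nhds (ereal r))"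
    proof eventually_elim
      case (elim y)
      then show ?case by (cases y) (auto simp: cdf_ext_def)
    qed
    ultimately show ?thesis
      using real isCont_cong by blast
  next
    case PInf
    have "(cdf_ext F \<longlongrightarrow> 1) (at \<infinity>)"
      unfolding at_infty_ereal_eq_at_top filterlim_filtermap
      using cdf by (simp add: cdf_ext_def is_cdf_def)
    then show ?thesis using PInf by (simp add: continuous_at cdf_ext_def)
  next
    case MInf
    have "(cdf_ext F \<longlongrightarrow> 0) (at_right (-\<infinity>))"
      unfolding at_right_MInf filterlim_filtermap
      using cdf by (simp add: cdf_ext_def is_cdf_def)
    \<comment> \<open>No point lies below minus infinity, so its punctured neighbourhoods are
      one-sided.\<close>
    moreover have "at (-\<infinity>::ereal) = at_right (-\<infinity>)"
    proof -
      have "UNIV - {-\<infinity>} = {-\<infinity><..} - {-\<infinity>::ereal}" by auto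
      then show ?thesis by (metis at_within_def)
    qed
    ultimately show ?thesis using MInf by (simp add: continuous_within cdf_ext_def)
  qed
  then show ?thesis by (simp add: continuous_at_imp_continuous_on)
qed

text \<open>If \<open>F r < 1\<close> at a finite \<open>y = r\<close>, continuity would give some
  \<open>x > r\<close> with \<open>F x < 1\<close>, beyond the supremum. Minus infinity is excluded
  because \<open>F\<close> tends to 0 there.\<close>

lemma cdf_ext_ge_Sup:
  assumes cdf: "is_cdf F" and F: "\<And>x. isCont F x" and y: "Sup (ereal ` {x. F x < 1}) \<le> y"
  shows "cdf_ext F y = 1"
proof -
  have le: "ereal x \<le> y" if "F x < 1" for x
    using that by (intro order_trans[OF Sup_upper y]) auto
  show ?thesis
  proof (cases y)
    case (real r)
    show ?thesis
    proof (rule ccontr)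
      assume "\<not> ?thesis"
      then have "F r < 1"
        using is_cdf_bounds(2)[OF cdf, of r] real by (simp add: cdf_ext_def)
      moreover have "(F \<longlongrightarrow> F r) (at_right r)"
        using F[of r] by (simp add: continuous_at filterlim_at_split)
      ultimately have "eventually (\<lambda>x. F x < 1 \<and> r < x) (at_right r)"
        by (intro eventually_conj order_tendstoD eventually_at_right_less)
      then obtain x where "F x < 1" "r < x"
        using eventually_happens'[OF trivial_limit_at_right_real] by blast
      then show False using le[of x] real by simp
    qed
  next
    case MInf
    have "eventually (\<lambda>x. F x < 1) at_bot"
      using cdf by (intro order_tendstoD) (auto simp: is_cdf_def)
    then obtain x where "F x < 1" using eventually_happens'[OF trivial_limit_at_bot_linorder] by blast
    then show ?thesis using le[of x] MInf by simp
  qed (simp add: cdf_ext_def)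
qed

text \<open>The mirror image: a positive value at a finite \<open>y\<close> would persist at some
  point to its left, below the infimum, and \<open>F\<close> tending to 1 excludes plus
  infinity.\<close>

lemma cdf_ext_le_Inf:
  assumes cdf: "is_cdf F" and F: "\<And>x. isCont F x" and y: "y \<le> Inf (ereal ` {x. F x > 0})"
  shows "cdf_ext F y = 0"
proof -
  have le: "y \<le> ereal x" if "F x > 0" for x
    using that by (intro order_trans[OF y Inf_lower]) auto
  show ?thesis
  proof (cases y)
    case (real r)
    show ?thesis
    proof (rule ccontr)
      assume "\<not> ?thesis"
      then have "0 < F r"
        using is_cdf_bounds(1)[OF cdf, of r] real by (simp add: cdf_ext_def)
      have "(F \<longlongrightarrow> F r) (at_left r)"
        using F[of r] by (simp add: continuous_at filterlim_at_split)
      then have "eventually (\<lambda>x. 0 < F x) (at_left r)"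
        using \<open>0 < F r\<close> by (rule order_tendstoD)
      moreover have "eventually (\<lambda>x. x < r) (at_left r)"
        by (simp add: eventually_at_filter)
      ultimately have "eventually (\<lambda>x. 0 < F x \<and> x < r) (at_left r)"
        by (rule eventually_conj)
      then obtain x where "0 < F x" "x < r"
        using eventually_happens'[OF trivial_limit_at_left_real] by blast
      then show False using le[of x] real by simp
    qed
  next
    case PInf
    have "eventually (\<lambda>x. 0 < F x) at_top"
      using cdf by (intro order_tendstoD) (auto simp: is_cdf_def)
    then obtain x where "0 < F x" using eventually_happens'[OF trivial_limit_at_top_linorder] by blast
    then show ?thesis using le[of x] PInf by simp
  qed (simp add: cdf_ext_def)
qed

text \<open>Each upper limit is the next lower limit, so the inner cdf values cancel.\<close>

lemma sum_integral_d_telescope: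
  fixes N :: nat
  assumes "N \<ge> 1" "\<And>j. j \<in> {1..<N} \<Longrightarrow> b j = a (j + 1)"
  shows "(\<Sum>j=1..N. integral_d F (a j) (b j)) = integral_d F (a 1) (b N)"
  using assms by (induction N rule: nat_induct_at_least) (auto simp: integral_d_def)

section \<open>Composition with the curve of cdf values\<close>

context
  fixes G :: "'m::finite \<Rightarrow> real \<Rightarrow> real"
  assumes G: "\<And>i. is_continuous_rv_cdf (G i)"
begin

lemma cdfs_in_cube: "(\<chi> i. G i x) \<in> {0..1}"
  using G is_cdf_bounds by (auto simp: less_eq_vec_def is_continuous_rv_cdf_def)

lemma cdfs_mono: "x \<le> y \<Longrightarrow> (\<chi> i. G i x) \<le> (\<chi> i. G i y)"
  using G by (auto simp: less_eq_vec_def is_continuous_rv_cdf_def is_cdf_def mono_def)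

lemma abs_cont_sum_cdfs: "abs_cont (\<lambda>x. \<Sum>i\<in>UNIV. G i x)"
  by (intro abs_cont_sum abs_cont_continuous_rv_cdf G)

text \<open>Since the \<open>G i\<close> are monotone, the curve of their values is 1-Lipschitz when
  parametrized by their sum.\<close>

lemma norm_cdfs_diff_le:
  "norm ((\<chi> i. G i y) - (\<chi> i. G i x)) \<le> \<bar>(\<Sum>i\<in>UNIV. G i y) - (\<Sum>i\<in>UNIV. G i x)\<bar>"
proof -
  have mono: "mono (G i)" for i using G by (auto simp: is_continuous_rv_cdf_def is_cdf_def)
  have "norm ((\<chi> i. G i y) - (\<chi> i. G i x)) \<le> (\<Sum>i\<in>UNIV. \<bar>G i y - G i x\<bar>)"
    using norm_le_l1_cart[of "(\<chi> i. G i y) - (\<chi> i. G i x)"] by simp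
  also have "\<dots> = \<bar>\<Sum>i\<in>UNIV. G i y - G i x\<bar>"
  proof (cases "x \<le> y")
    case True
    then show ?thesis using monoD[OF mono True] by (simp add: sum_nonneg)
  next
    case False
    then have "G i y \<le> G i x" for i using monoD[OF mono, of y x] by simp
    then have "(\<Sum>i\<in>UNIV. \<bar>G i y - G i x\<bar>) = - (\<Sum>i\<in>UNIV. G i y - G i x)" and
      "(\<Sum>i\<in>UNIV. G i y - G i x) \<le> 0"
      by (auto simp: sum_negf[symmetric] intro!: sum.cong sum_nonpos)
    then show ?thesis by simp
  qed
  also have "(\<Sum>i\<in>UNIV. G i y - G i x) = (\<Sum>i\<in>UNIV. G i y) - (\<Sum>i\<in>UNIV. G i x)"
    by (rule sum_subtractf)
  finally show ?thesis .
qed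

text \<open>A derivative at a point of the curve bounds the increment of \<open>k\<close> from there
  by a multiple of the distance on the curve, hence by a multiple of the increment of the sum of the
  cdfs. That sum is absolutely continuous, so it has (N).\<close>

lemma negligible_image_differentiable_at_cdfs:
  fixes k :: "real ^ 'm \<Rightarrow> real"
  assumes "negligible A"
    and diff: "\<And>x. x \<in> A \<Longrightarrow> k differentiable (at (\<chi> i. G i x) within {0..1})"
  shows "negligible (at_cdfs k G ` A)"
proof -
  let ?v = "\<lambda>x. \<chi> i. G i x"
  let ?g = "\<lambda>x. \<Sum>i\<in>UNIV. G i x"
  have "negligible (?g ` A)"
    using luzin_N_abs_cont[OF abs_cont_sum_cdfs] assms(1) by (auto simp: luzin_N_def)
  then show ?thesis
  proof (rule negligible_image_dominated)
    fix x assume "x \<in> A"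
    then obtain D where D: "(k has_derivative D) (at (?v x) within {0..1})"
      using diff by (auto simp: differentiable_def)
    \<comment> \<open>The definition of the derivative is used with accuracy 1 only; together with
      the operator bound \<open>K\<close> this gives the constant \<open>1 + K\<close>.\<close>
    then obtain e where e: "e > 0"
      "\<And>s. s \<in> {0..1} \<Longrightarrow> norm (s - ?v x) < e \<Longrightarrow>
        norm (k s - k (?v x) - D (s - ?v x)) \<le> 1 * norm (s - ?v x)"
      unfolding has_derivative_within_alt using zero_less_one by blast
    obtain K where K: "K > 0" "\<And>w. norm (D w) \<le> norm w * K"
      using bounded_linear.pos_bounded[OF has_derivative_bounded_linear[OF D]] by blast
    have "\<bar>k (?v y) - k (?v x)\<bar> \<le> (1 + K) * \<bar>?g y - ?g x\<bar>" if "\<bar>?g y - ?g x\<bar> < e" for y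
    proof -
      have le: "norm (?v y - ?v x) \<le> \<bar>?g y - ?g x\<bar>" by (rule norm_cdfs_diff_le)
      have "\<bar>k (?v y) - k (?v x)\<bar> \<le> norm (k (?v y) - k (?v x) - D (?v y - ?v x)) + norm (D (?v y - ?v x))"
        by (simp add: abs_triangle_ineq4 order_trans[OF _ abs_triangle_ineq])
      also have "\<dots> \<le> 1 * norm (?v y - ?v x) + norm (?v y - ?v x) * K"
        using le that by (intro add_mono e K cdfs_in_cube) auto
      also have "\<dots> = (1 + K) * norm (?v y - ?v x)" by (simp add: algebra_simps)
      also have "\<dots> \<le> (1 + K) * \<bar>?g y - ?g x\<bar>"
        using K by (intro mult_left_mono le) auto
      finally show ?thesis .
    qed
    then show "\<exists>e>0. \<exists>B. \<forall>y\<in>A. \<bar>?g y - ?g x\<bar> < e \<longrightarrow>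
        \<bar>at_cdfs k G y - at_cdfs k G x\<bar> \<le> B * \<bar>?g y - ?g x\<bar>"
      unfolding at_cdfs_def using e(1) by blast
  qed
qed

lemma luzin_N_at_cdfs:
  assumes "k differentiable_on {0..1}"
  shows "luzin_N (at_cdfs k G)"
  unfolding luzin_N_def
  using assms cdfs_in_cube
  by (auto simp: differentiable_on_def intro!: negligible_image_differentiable_at_cdfs)

text \<open>Where \<open>h\<close> is finite its differentiability gives a null image, which
  \<open>F\<close> maps to a null set by (N). Where \<open>h\<close> is infinite, only the values 0
  and 1 can arise.\<close>

lemma luzin_N_cdf_ext_at_cdfs:
  assumes F: "is_continuous_rv_cdf F" and h: "differentiable_where_finite h"
  shows "luzin_N (at_cdfs (\<lambda>t. cdf_ext F (h t)) G)"
  unfolding luzin_N_def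
proof (intro allI impI)
  fix A :: "real set" assume A: "negligible A"
  define A' where "A' = {x \<in> A. \<bar>at_cdfs h G x\<bar> \<noteq> \<infinity>}"
  have "negligible A'" using A by (rule negligible_subset) (auto simp: A'_def)
  then have "negligible (at_cdfs (\<lambda>t. real_of_ereal (h t)) G ` A')"
    using h cdfs_in_cube
    by (intro negligible_image_differentiable_at_cdfs)
       (auto simp: A'_def differentiable_where_finite_def at_cdfs_def)
  then have "negligible (F ` at_cdfs (\<lambda>t. real_of_ereal (h t)) G ` A')"
    using luzin_N_continuous_rv_cdf[OF F] by (auto simp: luzin_N_def)
  moreover have "negligible {0, 1 :: real}"
    by (simp add: negligible_finite)
  moreover have "at_cdfs (\<lambda>t. cdf_ext F (h t)) G ` A \<subseteq>
      F ` at_cdfs (\<lambda>t. real_of_ereal (h t)) G ` A' \<union> {0, 1}"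
  proof
    fix u assume "u \<in> at_cdfs (\<lambda>t. cdf_ext F (h t)) G ` A"
    then obtain x where x: "x \<in> A" "u = cdf_ext F (at_cdfs h G x)" by (auto simp: at_cdfs_def)
    show "u \<in> F ` at_cdfs (\<lambda>t. real_of_ereal (h t)) G ` A' \<union> {0, 1}"
    proof (cases "at_cdfs h G x")
      case (real r)
      then have "x \<in> A'" "u = F (at_cdfs (\<lambda>t. real_of_ereal (h t)) G x)"
        using x by (auto simp: A'_def cdf_ext_def at_cdfs_def)
      then show ?thesis by blast
    qed (use x in \<open>auto simp: cdf_ext_def\<close>)
  qed
  ultimately show "negligible (at_cdfs (\<lambda>t. cdf_ext F (h t)) G ` A)"
    using negligible_Un negligible_subset by blast
qed

lemma isCont_at_cdfs:
  fixes k :: "real ^ 'm \<Rightarrow> real"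
  assumes "continuous_on {0..1} k"
  shows "isCont (at_cdfs k G) x"
proof -
  have "isCont (G i) x" for i x
    using G abs_cont_continuous_rv_cdf isCont_abs_cont by blast
  then have "continuous_on UNIV (\<lambda>x. \<chi> i. G i x)"
    by (intro continuous_on_vec_lambda continuous_at_imp_continuous_on) auto
  then have "continuous_on UNIV (\<lambda>x. k (\<chi> i. G i x))"
    by (rule continuous_on_compose2[OF assms]) (use cdfs_in_cube in auto)
  then show ?thesis
    unfolding at_cdfs_def by (simp add: continuous_on_eq_continuous_at)
qed

text \<open>The curve runs from the corner 0 to the corner 1 without leaving the cube, so continuity
  on the cube determines both limits.\<close>

lemma tendsto_at_cdfs:
  fixes k :: "real ^ 'm \<Rightarrow> real"
  assumes "continuous_on {0..1} k"
  shows "(at_cdfs k G \<longlongrightarrow> k 0) at_bot" "(at_cdfs k G \<longlongrightarrow> k 1) at_top"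
proof -
  have lim: "(G i \<longlongrightarrow> 0) at_bot" "(G i \<longlongrightarrow> 1) at_top" for i
    using G by (auto simp: is_continuous_rv_cdf_def is_cdf_def)
  have "((\<lambda>x. \<chi> i. G i x) \<longlongrightarrow> (\<chi> i. 0)) at_bot" "((\<lambda>x. \<chi> i. G i x) \<longlongrightarrow> (\<chi> i. 1)) at_top"
    by (intro tendsto_vec_lambda lim)+
  then have "((\<lambda>x. \<chi> i. G i x) \<longlongrightarrow> 0) at_bot" "((\<lambda>x. \<chi> i. G i x) \<longlongrightarrow> 1) at_top"
    by (simp_all add: zero_vec_def one_vec_def)
  moreover have "(0 :: real ^ 'm) \<in> {0..1}" "(1 :: real ^ 'm) \<in> {0..1}"
    by (auto simp: less_eq_vec_def)
  ultimately show "(at_cdfs k G \<longlongrightarrow> k 0) at_bot" "(at_cdfs k G \<longlongrightarrow> k 1) at_top"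
    unfolding at_cdfs_def[abs_def]
    by (auto intro: continuous_on_tendsto_compose[OF assms _ _ always_eventually] cdfs_in_cube
        simp del: atLeastAtMost_iff)
qed

lemma mono_at_cdfs:
  fixes k :: "real ^ 'm \<Rightarrow> real"
  assumes "mono_on {0..1} k"
  shows "mono (at_cdfs k G)"
  using assms cdfs_in_cube cdfs_mono unfolding at_cdfs_def mono_on_def mono_def by blast

text \<open>Monotonicity, continuity and the limits at both ends are inherited from
  \<open>k\<close>, which leaves (N) as the only condition on the composite.\<close>

lemma abs_cont_at_cdfs_mono:
  fixes k :: "real ^ 'm \<Rightarrow> real"
  assumes "continuous_on {0..1} k" "mono_on {0..1} k" "luzin_N (at_cdfs k G)"
  shows "abs_cont (at_cdfs k G)"
  using assms by (intro abs_cont_mono[OF mono_at_cdfs isCont_at_cdfs _ tendsto_at_cdfs])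

lemma abs_cont_at_cdfs_antimono:
  fixes k :: "real ^ 'm \<Rightarrow> real"
  assumes "continuous_on {0..1} k" "antimono_on {0..1} k" "luzin_N (at_cdfs k G)"
  shows "abs_cont (at_cdfs k G)"
proof -
  have "abs_cont (at_cdfs (\<lambda>t. - k t) G)"
  proof (rule abs_cont_at_cdfs_mono)
    show "mono_on {0..1} (\<lambda>t. - k t)"
      using assms(2) by (auto simp: monotone_on_def)
    show "luzin_N (at_cdfs (\<lambda>t. - k t) G)"
      using luzin_N_uminus[OF assms(3)] by (simp add: at_cdfs_def[abs_def])
  qed (intro continuous_intros assms)
  then have "abs_cont (\<lambda>x. 0 - at_cdfs (\<lambda>t. - k t) G x)"
    by (intro abs_cont_diff abs_cont_const)
  then show ?thesis by (simp add: at_cdfs_def[abs_def])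
qed

lemma is_cdf_at_cdfs:
  fixes k :: "real ^ 'm \<Rightarrow> real"
  assumes "continuous_on {0..1} k" "mono_on {0..1} k" "k 0 = 0" "k 1 = 1"
  shows "is_cdf (at_cdfs k G)"
  using mono_at_cdfs[OF assms(2)] isCont_at_cdfs[OF assms(1)] tendsto_at_cdfs[OF assms(1)] assms(3,4)
  by (auto simp: is_cdf_def intro: continuous_at_imp_continuous_at_within)

end

section \<open>The generated functions\<close>

text \<open>\<open>integral_d\<close> is a signed difference of cdf values, so raising the upper
  limit and lowering the lower one each increase it.\<close>

lemma mono_on_sum_integral_d:
  assumes F: "is_cdf F"
    and a: "\<And>j. j \<in> J \<Longrightarrow> antimono_on S (a j)" and b: "\<And>j. j \<in> J \<Longrightarrow> mono_on S (b j)"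
  shows "mono_on S (\<lambda>t. \<Sum>j\<in>J. integral_d F (a j t) (b j t))"
proof (rule mono_onI)
  fix s t assume st: "s \<in> S" "t \<in> S" "s \<le> t"
  show "(\<Sum>j\<in>J. integral_d F (a j s) (b j s)) \<le> (\<Sum>j\<in>J. integral_d F (a j t) (b j t))"
    unfolding integral_d_def
  proof (intro sum_mono diff_mono monoD[OF mono_cdf_ext[OF F]])
    fix j assume "j \<in> J"
    then show "b j s \<le> b j t" "a j t \<le> a j s"
      using a b st by (auto simp: monotone_on_def)
  qed
qed

lemma antimono_on_sum_integral_d:
  assumes F: "is_cdf F"
    and a: "\<And>j. j \<in> J \<Longrightarrow> mono_on S (a j)" and b: "\<And>j. j \<in> J \<Longrightarrow> antimono_on S (b j)"
  shows "antimono_on S (\<lambda>t. \<Sum>j\<in>J. integral_d F (a j t) (b j t))"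
proof -
  have "mono_on S (\<lambda>t. \<Sum>j\<in>J. integral_d F (b j t) (a j t))"
    by (rule mono_on_sum_integral_d[OF F b a])
  moreover have "(\<Sum>j\<in>J. integral_d F (a j t) (b j t)) = - (\<Sum>j\<in>J. integral_d F (b j t) (a j t))" for t
    by (simp add: integral_d_def sum_negf[symmetric])
  ultimately show ?thesis by (simp add: monotone_on_def)
qed

lemma integral_d_nonneg:
  assumes "is_cdf F" "a \<le> b"
  shows "0 \<le> integral_d F a b"
  using monoD[OF mono_cdf_ext[OF assms(1)] assms(2)] by (simp add: integral_d_def)

text \<open>If \<open>s a\<close> is nonnegative, so is \<open>s\<close> throughout, and two
  nonnegative non-decreasing factors are multiplied. If \<open>u b = 0\<close>, then
  \<open>u\<close> vanishes identically; this alternative occurs in Form B, where the order of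
  \<open>l\<close> and \<open>\<mu>\<close> at 0 is given only for
  \<open>U 1 \<noteq> 0\<close>.\<close>

lemma mono_on_mult_nonneg:
  fixes u s :: "'a :: order \<Rightarrow> real"
  assumes u: "mono_on {a..b} u" "\<And>t. t \<in> {a..b} \<Longrightarrow> 0 \<le> u t"
    and s: "mono_on {a..b} s" "u b = 0 \<or> 0 \<le> s a"
  shows "mono_on {a..b} (\<lambda>t. u t * s t)"
proof (rule mono_onI)
  fix x y assume xy: "x \<in> {a..b}" "y \<in> {a..b}" "x \<le> y"
  then have ab: "a \<in> {a..b}" "b \<in> {a..b}" by (auto intro: order_trans)
  show "u x * s x \<le> u y * s y"
    using s(2)
  proof
    assume "u b = 0"
    then have "u t = 0" if "t \<in> {a..b}" for t
      using u(2)[OF that] mono_onD[OF u(1) that ab(2)] that by auto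
    then show ?thesis using xy by simp
  next
    assume "0 \<le> s a"
    then have "0 \<le> s x" using mono_onD[OF s(1) ab(1) xy(1)] xy by auto
    then show ?thesis
      using u s xy by (intro mult_mono) (auto dest: mono_onD)
  qed
qed

text \<open>The same argument with the ends exchanged: \<open>u\<close> is largest at
  \<open>a\<close> and \<open>s\<close> smallest at \<open>b\<close>. The alternative
  \<open>u a = 0\<close> covers \<open>\<theta> 0 = 0\<close> in Form A.\<close>

lemma antimono_on_mult_nonneg:
  fixes u s :: "'a :: order \<Rightarrow> real"
  assumes u: "antimono_on {a..b} u" "\<And>t. t \<in> {a..b} \<Longrightarrow> 0 \<le> u t"
    and s: "antimono_on {a..b} s" "u a = 0 \<or> 0 \<le> s b"
  shows "antimono_on {a..b} (\<lambda>t. u t * s t)"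
proof (rule monotone_onI)
  fix x y assume xy: "x \<in> {a..b}" "y \<in> {a..b}" "x \<le> y"
  then have ab: "a \<in> {a..b}" "b \<in> {a..b}" by (auto intro: order_trans)
  have le: "u y \<le> u x" "s y \<le> s x" using monotone_onD[OF u(1) xy] monotone_onD[OF s(1) xy] by auto
  show "u x * s x \<ge> u y * s y"
    using s(2)
  proof
    assume "u a = 0"
    then have "u t = 0" if "t \<in> {a..b}" for t
      using u(2)[OF that] monotone_onD[OF u(1) ab(1) that] that by auto
    then show ?thesis using xy by simp
  next
    assume "0 \<le> s b"
    then have "0 \<le> s y" using monotone_onD[OF s(1) xy(2) ab(2)] xy by auto
    then show ?thesis
      using u(2) xy le by (intro mult_mono) auto
  qed
qed

context generator
begin

text \<open>As functions on the cube, before the cdfs are substituted, \<open>S\<close> and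
  \<open>R\<close> can be evaluated at the corners, where the conditions of the two forms are
  stated.\<close>

definition S :: "real ^ 'm \<Rightarrow> real" where
  "S t = (\<Sum>j=1..N. integral_d F (l j t) (\<mu> j t))"

definition R :: "real ^ 'm \<Rightarrow> real" where
  "R t = (\<Sum>j=1..N. integral_d F (m j t) (\<nu> j t))"

lemma generated_A_eq: "generated_A N F U \<theta> \<mu> l \<nu> m G = at_cdfs (\<lambda>t. U t * S t - \<theta> t * R t) G"
  by (simp add: fun_eq_iff generated_A_def at_cdfs_def S_def R_def)

lemma generated_B_eq: "generated_B N F U \<theta> \<mu> l \<nu> m G = at_cdfs (\<lambda>t. 1 - \<theta> t * R t + U t * S t) G"
  by (simp add: fun_eq_iff generated_B_def at_cdfs_def S_def R_def)

lemma mono_S: "mono_on {0..1} S"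
  unfolding S_def by (intro mono_on_sum_integral_d F_cdf nondecreasing nonincreasing)

lemma antimono_R: "antimono_on {0..1} R"
  unfolding R_def by (intro antimono_on_sum_integral_d F_cdf nondecreasing nonincreasing)

lemma mono_U_S:
  assumes "U 1 = 0 \<or> 0 \<le> S 0"
  shows "mono_on {0..1} (\<lambda>t. U t * S t)"
  using nonneg assms by (intro mono_on_mult_nonneg nondecreasing mono_S) auto

lemma antimono_\<theta>_R:
  assumes "\<theta> 0 = 0 \<or> 0 \<le> R 1"
  shows "antimono_on {0..1} (\<lambda>t. \<theta> t * R t)"
  using nonneg assms by (intro antimono_on_mult_nonneg nonincreasing antimono_R) auto

lemma S_eq_0: "\<forall>j\<in>{1..N}. \<mu> j t = l j t \<Longrightarrow> S t = 0"
  by (simp add: S_def integral_d_def)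

lemma R_eq_0: "\<forall>j\<in>{1..N}. m j t = \<nu> j t \<Longrightarrow> R t = 0"
  by (simp add: R_def integral_d_def)

lemma S_eq_R: "\<forall>j\<in>{1..N}. \<mu> j t = \<nu> j t \<and> m j t = l j t \<Longrightarrow> S t = R t"
  by (simp add: S_def R_def)

lemma S_nonneg: "(\<And>j. j \<in> {1..N} \<Longrightarrow> l j t \<le> \<mu> j t) \<Longrightarrow> 0 \<le> S t"
  unfolding S_def by (intro sum_nonneg integral_d_nonneg F_cdf)

lemma R_nonneg: "(\<And>j. j \<in> {1..N} \<Longrightarrow> m j t \<le> \<nu> j t) \<Longrightarrow> 0 \<le> R t"
  unfolding R_def by (intro sum_nonneg integral_d_nonneg F_cdf)

end

section \<open>Continuous and differentiable data, common to both forms\<close>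

locale smooth_generator = generator +
  assumes G_rv: "\<And>i. is_continuous_rv_cdf (G i)"
    and F_rv: "is_continuous_rv_cdf F"
    and U_cont: "continuous_on {0..1} U" and U_diff: "U differentiable_on {0..1}"
    and \<theta>_cont: "continuous_on {0..1} \<theta>" and \<theta>_diff: "\<theta> differentiable_on {0..1}"
    and h_cont: "\<And>j h. j \<in> {1..N} \<Longrightarrow> h \<in> {\<mu> j, l j, \<nu> j, m j} \<Longrightarrow> continuous_on {0..1} h"
    and h_diff: "\<And>j h. j \<in> {1..N} \<Longrightarrow> h \<in> {\<mu> j, l j, \<nu> j, m j} \<Longrightarrow> differentiable_where_finite h"
begin

lemma F_cont: "isCont F x"
  using F_rv is_continuous_rv_cdf_iff_abs_cont isCont_abs_cont by blast

lemma continuous_cdf_ext_limit: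
  assumes "j \<in> {1..N}" "h \<in> {\<mu> j, l j, \<nu> j, m j}"
  shows "continuous_on {0..1} (\<lambda>t. cdf_ext F (h t))"
  by (rule continuous_on_compose2[OF continuous_cdf_ext[OF F_cdf F_cont] h_cont[OF assms]]) auto

text \<open>Each limit function is monotone in one direction or the other, and composing with the
  extended cdf preserves the direction; (N) then yields absolute continuity.\<close>

lemma abs_cont_cdf_ext_limit:
  assumes j: "j \<in> {1..N}" and h: "h \<in> {\<mu> j, l j, \<nu> j, m j}"
  shows "abs_cont (at_cdfs (\<lambda>t. cdf_ext F (h t)) G)"
proof -
  note luzin = luzin_N_cdf_ext_at_cdfs[OF G_rv F_rv h_diff[OF j h]]
  have "mono_on {0..1} h \<or> antimono_on {0..1} h"
    using nondecreasing(2,3)[OF j] nonincreasing(2,3)[OF j] h by auto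
  then show ?thesis
  proof
    assume "mono_on {0..1} h"
    then have "mono_on {0..1} (\<lambda>t. cdf_ext F (h t))"
      using mono_cdf_ext[OF F_cdf] by (auto simp: monotone_on_def)
    then show ?thesis
      by (rule abs_cont_at_cdfs_mono[OF G_rv continuous_cdf_ext_limit[OF j h] _ luzin])
  next
    assume "antimono_on {0..1} h"
    then have "antimono_on {0..1} (\<lambda>t. cdf_ext F (h t))"
      using mono_cdf_ext[OF F_cdf] by (auto simp: monotone_on_def)
    then show ?thesis
      by (rule abs_cont_at_cdfs_antimono[OF G_rv continuous_cdf_ext_limit[OF j h] _ luzin])
  qed
qed

lemma continuous_S: "continuous_on {0..1} S" and continuous_R: "continuous_on {0..1} R"
  unfolding S_def R_def integral_d_def
  by (auto intro!: continuous_on_sum continuous_on_diff continuous_cdf_ext_limit)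

lemma abs_cont_S: "abs_cont (at_cdfs S G)" and abs_cont_R: "abs_cont (at_cdfs R G)"
  using abs_cont_cdf_ext_limit unfolding S_def R_def integral_d_def at_cdfs_def[abs_def]
  by (auto intro!: abs_cont_sum abs_cont_diff)

lemma abs_cont_U: "abs_cont (at_cdfs U G)"
  by (intro abs_cont_at_cdfs_mono G_rv U_cont nondecreasing luzin_N_at_cdfs U_diff)

lemma abs_cont_\<theta>: "abs_cont (at_cdfs \<theta> G)"
  by (intro abs_cont_at_cdfs_antimono G_rv \<theta>_cont nonincreasing luzin_N_at_cdfs \<theta>_diff)

text \<open>The sum collapses to the extended cdf at the last upper limit, which is 1, minus its
  value at the first lower limit, which is 0.\<close>

lemma S_telescope:
  assumes "\<And>j. j \<in> {1..<N} \<Longrightarrow> \<mu> j t = l (j + 1) t"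
    and "\<mu> N t \<ge> Sup (ereal ` {x. F x < 1})" and "l 1 t \<le> Inf (ereal ` {x. F x > 0})"
  shows "S t = 1"
  using sum_integral_d_telescope[OF N_pos, of "\<lambda>j. \<mu> j t" "\<lambda>j. l j t" F] assms
    cdf_ext_ge_Sup[OF F_cdf F_cont] cdf_ext_le_Inf[OF F_cdf F_cont]
  by (simp add: S_def integral_d_def)

lemma R_telescope:
  assumes "\<And>j. j \<in> {1..<N} \<Longrightarrow> \<nu> j t = m (j + 1) t"
    and "\<nu> N t \<ge> Sup (ereal ` {x. F x < 1})" and "m 1 t \<le> Inf (ereal ` {x. F x > 0})"
  shows "R t = 1"
  using sum_integral_d_telescope[OF N_pos, of "\<lambda>j. \<nu> j t" "\<lambda>j. m j t" F] assms
    cdf_ext_ge_Sup[OF F_cdf F_cont] cdf_ext_le_Inf[OF F_cdf F_cont]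
  by (simp add: R_def integral_d_def)

text \<open>On the cube the generated function is a non-decreasing minus a non-increasing product,
  with values 0 and 1 at the corners, which makes the composite a cdf. Absolute continuity is then
  assembled factor by factor.\<close>

lemma generated_A_continuous_rv:
  assumes "form_A N F U \<theta> \<mu> l \<nu> m G"
  shows "is_continuous_rv_cdf (generated_A N F U \<theta> \<mu> l \<nu> m G)"
proof -
  interpret form_A N F U \<theta> \<mu> l \<nu> m G by fact
  have US: "mono_on {0..1} (\<lambda>t. U t * S t)"
    by (intro mono_U_S disjI2 S_nonneg l_le_\<mu>)
  have "\<theta> 0 = 0 \<or> 0 \<le> R 1"
    using m_le_\<nu> R_nonneg by blast
  then have \<theta>R: "antimono_on {0..1} (\<lambda>t. \<theta> t * R t)"
    by (rule antimono_\<theta>_R)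
  \<comment> \<open>With equal nonzero weights the brackets agree and the products cancel; with
    unequal weights each product vanishes separately.\<close>
  have 0: "U 0 * S 0 - \<theta> 0 * R 0 = 0"
  proof (cases "U 0 = \<theta> 0")
    case True
    then show ?thesis using equal_at_0 S_eq_R[of 0] by (cases "U 0 = 0") auto
  next
    case False
    then show ?thesis using unequal_at_0 S_eq_0[of 0] R_eq_0[of 0] by auto
  qed
  have "\<theta> 1 * R 1 = 0"
    using \<theta>_at_1 R_eq_0[of 1] by auto
  moreover have "S 1 = 1"
    by (intro S_telescope chain \<mu>_last l_first)
  ultimately have 1: "U 1 * S 1 - \<theta> 1 * R 1 = 1"
    using U_at_1 by simp
  have "is_cdf (at_cdfs (\<lambda>t. U t * S t - \<theta> t * R t) G)"
  proof (rule is_cdf_at_cdfs[OF G_rv])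
    show "mono_on {0..1} (\<lambda>t. U t * S t - \<theta> t * R t)"
      using US \<theta>R by (auto simp: monotone_on_def intro!: diff_mono)
  qed (intro continuous_intros U_cont \<theta>_cont continuous_S continuous_R 0 1)+
  moreover have "abs_cont (\<lambda>x. at_cdfs U G x * at_cdfs S G x - at_cdfs \<theta> G x * at_cdfs R G x)"
    by (intro abs_cont_diff abs_cont_mult abs_cont_U abs_cont_S abs_cont_\<theta> abs_cont_R)
  ultimately show ?thesis
    by (simp add: is_continuous_rv_cdf_iff_abs_cont generated_A_eq at_cdfs_def[abs_def])
qed

text \<open>The corners exchange roles compared with Form A: the products cancel or vanish at 1, and
  the telescoping sum is \<open>R\<close> at 0.\<close>

lemma generated_B_continuous_rv:
  assumes "form_B N F U \<theta> \<mu> l \<nu> m G"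
  shows "is_continuous_rv_cdf (generated_B N F U \<theta> \<mu> l \<nu> m G)"
proof -
  interpret form_B N F U \<theta> \<mu> l \<nu> m G by fact
  have "U 1 = 0 \<or> 0 \<le> S 0"
    using l_le_\<mu> S_nonneg by blast
  then have US: "mono_on {0..1} (\<lambda>t. U t * S t)"
    by (rule mono_U_S)
  have \<theta>R: "antimono_on {0..1} (\<lambda>t. \<theta> t * R t)"
    by (intro antimono_\<theta>_R disjI2 R_nonneg m_le_\<nu>)
  have 1: "1 - \<theta> 1 * R 1 + U 1 * S 1 = 1"
  proof (cases "U 1 = \<theta> 1")
    case True
    then show ?thesis using equal_at_1 S_eq_R[of 1] by (cases "U 1 = 0") auto
  next
    case False
    then show ?thesis using unequal_at_1 S_eq_0[of 1] R_eq_0[of 1] by auto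
  qed
  have "U 0 * S 0 = 0"
    using U_at_0 S_eq_0[of 0] by auto
  moreover have "R 0 = 1"
    by (intro R_telescope chain \<nu>_last m_first)
  ultimately have 0: "1 - \<theta> 0 * R 0 + U 0 * S 0 = 0"
    using \<theta>_at_0 by simp
  have "is_cdf (at_cdfs (\<lambda>t. 1 - \<theta> t * R t + U t * S t) G)"
  proof (rule is_cdf_at_cdfs[OF G_rv])
    show "mono_on {0..1} (\<lambda>t. 1 - \<theta> t * R t + U t * S t)"
      using US \<theta>R by (auto simp: monotone_on_def intro!: add_mono diff_mono)
  qed (intro continuous_intros U_cont \<theta>_cont continuous_S continuous_R 0 1)+
  moreover have "abs_cont (\<lambda>x. 1 - at_cdfs \<theta> G x * at_cdfs R G x + at_cdfs U G x * at_cdfs S G x)"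
    by (intro abs_cont_diff abs_cont_add abs_cont_const abs_cont_mult
        abs_cont_U abs_cont_S abs_cont_\<theta> abs_cont_R)
  ultimately show ?thesis
    by (simp add: is_continuous_rv_cdf_iff_abs_cont generated_B_eq at_cdfs_def[abs_def])
qed

end

theorem theorem6:
  fixes N :: nat
    and F :: "real \<Rightarrow> real"
    and U \<theta> :: "real ^ 'm::finite \<Rightarrow> real"
    and \<mu> l \<nu> m :: "nat \<Rightarrow> real ^ 'm \<Rightarrow> ereal"
    and G :: "'m \<Rightarrow> real \<Rightarrow> real"
  assumes "\<forall>i. is_continuous_rv_cdf (G i)"
    and "is_continuous_rv_cdf F"
    and "continuous_on {0..1} U" and "U differentiable_on {0..1}"
    and "continuous_on {0..1} \<theta>" and "\<theta> differentiable_on {0..1}"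
    and "\<forall>j\<in>{1..N}. \<forall>h\<in>{\<mu> j, l j, \<nu> j, m j}.
           continuous_on {0..1} h \<and> differentiable_where_finite h"
  shows "(form_A N F U \<theta> \<mu> l \<nu> m G \<longrightarrow>
            is_continuous_rv_cdf (generated_A N F U \<theta> \<mu> l \<nu> m G)) \<and>
         (form_B N F U \<theta> \<mu> l \<nu> m G \<longrightarrow>
            is_continuous_rv_cdf (generated_B N F U \<theta> \<mu> l \<nu> m G))"
proof -
  \<comment> \<open>Either form contains the conditions of \<open>generator\<close>, so a single
    extension by the smoothness hypotheses serves both.\<close>
  have smooth: "smooth_generator N F U \<theta> \<mu> l \<nu> m G" if "generator N F U \<theta> \<mu> l \<nu> m G"
    using that assms unfolding smooth_generator_def smooth_generator_axioms_def by blast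
  show ?thesis
    using smooth smooth_generator.generated_A_continuous_rv smooth_generator.generated_B_continuous_rv
    by (metis form_A.axioms(1) form_B.axioms(1))
qed

end
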